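(* Let $n\ge 0$ be an integer such that $\operatorname{reg}_{n+1}^R(k)=0$. Then for all integers $i$ with $0\le i\le n$ one has $$H_i(K)_j=0\quad\text{for all } j>2i,\qquad\text{and}\qquad H_i(K)_{2i}=(H_1(K)_2)^i,$$ where the $i$-th power is the $k$-span of the $i$-fold products of elements of $H_1(K)_2$ in the algebra $H(K)$.
   Context: $k$ is a field and $R=\bigoplus_{i\ge0}R_i$ is a commutative graded $k$-algebra with $R_0=k$, $R=k[R_1]$ and $\operatorname{rank}_kR_1$ finite. The $R$-module $k$ is $R/\bigoplus_{i\ge1}R_i$. For a graded vector space $V$, $\operatorname{top}(V)=\sup\{j\mid V_j\ne0\}$ (equal to $-\infty$ if $V=0$). Put $t_i^R(k)=\operatorname{top}(\operatorname{Tor}_i^R(k,k))$ and $\operatorname{reg}_n^R(k)=\max_{i\le n}\{t_i^R(k)-i\}$. $K$ is the Koszul complex of the $R$-linear map $R\otimes_kR_1(-1)\to R$ induced by the inclusion $R_1\subseteq R$: its underlying algebra is the exterior algebra over $R$ on the free module $R\otimes_k R_1(-1)$, placed in homological degree $1$ and with basis in internal degree $1$; the differential lowers homological degree by $1$ and preserves internal degree. Thus $H(K)$ is a bigraded algebra, and $H_i(K)_j$ is its component of homological degree $i$ and internal degree $j$. *)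

theory Defs
  imports Complex_Main "HOL-Library.Set_Algebras" "HOL-Library.Function_Algebras"
    "HOL-Library.Extended_Real"
begin

section \<open>Standard graded algebras\<close>

text \<open>
  The ring \<open>R\<close> is the whole type \<open>'r\<close>, with structure of \<open>k\<close>-vector space \<open>scale\<close> and graded
  pieces \<open>Rg i\<close>.
\<close>

locale standard_graded_algebra = vector_space scale
  for scale :: "'k::field \<Rightarrow> 'r::comm_ring_1 \<Rightarrow> 'r" +
  fixes Rg :: "nat \<Rightarrow> 'r set"
  assumes scale_mult: "scale c (x * y) = scale c x * y"
    and subspace_piece: "subspace (Rg i)"
    and piece_mult: "x \<in> Rg i \<Longrightarrow> y \<in> Rg j \<Longrightarrow> x * y \<in> Rg (i + j)"
    and direct_sum: "\<exists>!f. (\<forall>i. f i \<in> Rg i) \<and> finite {i. f i \<noteq> 0} \<and> (\<Sum>i | f i \<noteq> 0. f i) = x"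
    and piece_0: "Rg 0 = range (\<lambda>c. scale c 1)"
    and generated_in_degree_1:
      "subspace S \<Longrightarrow> 1 \<in> S \<Longrightarrow> (\<And>x y. x \<in> S \<Longrightarrow> y \<in> S \<Longrightarrow> x * y \<in> S) \<Longrightarrow> Rg 1 \<subseteq> S
        \<Longrightarrow> S = UNIV"
    and finite_rank_1: "\<exists>X. finite X \<and> span X = Rg 1"

definition irrelevant_ideal :: "('k::field \<Rightarrow> 'r::comm_ring_1 \<Rightarrow> 'r) \<Rightarrow> (nat \<Rightarrow> 'r set) \<Rightarrow> 'r set" where
  "irrelevant_ideal scale Rg = module.span scale (\<Union>i\<in>{1..}. Rg i)"

definition ordered_basis ::
    "('k::field \<Rightarrow> 'r::comm_ring_1 \<Rightarrow> 'r) \<Rightarrow> 'r set \<Rightarrow> 'r list \<Rightarrow> bool" where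
  "ordered_basis scale V xs \<longleftrightarrow>
     distinct xs \<and> \<not> module.dependent scale (set xs) \<and> module.span scale (set xs) = V"

text \<open>
  The quotient \<open>(Z + N) / N\<close>, as a set of cosets of \<open>N\<close>: the image of \<open>Z\<close> in the quotient of the
  ambient group by \<open>N\<close>. Its zero element is \<open>N\<close>, so it vanishes iff it equals \<open>{N}\<close>.
\<close>

definition image_mod :: "'a::ab_group_add set \<Rightarrow> 'a set \<Rightarrow> 'a set set" where
  "image_mod Z N = (\<lambda>z. z +o N) ` Z"


section \<open>Graded free resolutions of the residue field\<close>

definition int_piece :: "(nat \<Rightarrow> 'r::comm_ring_1 set) \<Rightarrow> int \<Rightarrow> 'r set" where
  "int_piece Rg m = (if m < 0 then {0} else Rg (nat m))"

text \<open>
  The component of internal degree \<open>j\<close> of the free module on \<open>X\<close>, the element \<open>b\<close> of \<open>X\<close> being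
  placed in degree \<open>deg b\<close>.
\<close>

definition free_component :: "(nat \<Rightarrow> 'r::comm_ring_1 set) \<Rightarrow> ('r \<Rightarrow> 'm::ab_group_add \<Rightarrow> 'm)
    \<Rightarrow> ('m \<Rightarrow> int) \<Rightarrow> 'm set \<Rightarrow> int \<Rightarrow> 'm set" where
  "free_component Rg smul deg X j =
     {(\<Sum>b\<in>A. smul (c b) b) | A c. finite A \<and> A \<subseteq> X \<and> (\<forall>b\<in>A. c b \<in> int_piece Rg (j - deg b))}"

text \<open>
  A resolution \<open>\<dots> \<rightarrow> F\<^sub>1 \<rightarrow> F\<^sub>0 \<rightarrow> k \<rightarrow> 0\<close>, not assumed minimal, is given by its total module
  \<open>\<Oplus>\<^sub>i F\<^sub>i\<close>, which is the whole type \<open>'m\<close>; \<open>B i\<close> is a homogeneous \<open>R\<close>-basis of \<open>F\<^sub>i\<close>. The augmentation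
  \<open>eps\<close> is only relevant on \<open>F\<^sub>0\<close>. Its \<open>R\<close>-linearity is expressed by \<open>k\<close>-linearity together with
  \<open>eps_irrelevant\<close>, since \<open>R\<close> acts on \<open>k\<close> through \<open>R \<rightarrow> R / R\<^sub>+ = k\<close>.
\<close>

locale graded_free_resolution =
  standard_graded_algebra scale Rg + F: module smul
  for scale :: "'k::field \<Rightarrow> 'r::comm_ring_1 \<Rightarrow> 'r" and Rg :: "nat \<Rightarrow> 'r set"
    and smul :: "'r \<Rightarrow> 'm::ab_group_add \<Rightarrow> 'm" +
  fixes B :: "nat \<Rightarrow> 'm set" and deg :: "'m \<Rightarrow> int" and d :: "'m \<Rightarrow> 'm" and eps :: "'m \<Rightarrow> 'k"
  assumes disjoint: "i \<noteq> i' \<Longrightarrow> B i \<inter> B i' = {}"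
    and independent: "F.independent (\<Union>i. B i)"
    and spanning: "F.span (\<Union>i. B i) = UNIV"
    and d_linear: "module_hom smul smul d"
    and d_component: "z \<in> free_component Rg smul deg (B (Suc i)) j
          \<Longrightarrow> d z \<in> free_component Rg smul deg (B i) j"
    and d_0: "z \<in> F.span (B 0) \<Longrightarrow> d z = 0"
    and d_exact: "{z \<in> F.span (B (Suc i)). d z = 0} = d ` F.span (B (Suc (Suc i)))"
    and eps_add: "x \<in> F.span (B 0) \<Longrightarrow> y \<in> F.span (B 0) \<Longrightarrow> eps (x + y) = eps x + eps y"
    and eps_scale: "x \<in> F.span (B 0) \<Longrightarrow> eps (smul (scale c 1) x) = c * eps x"
    and eps_irrelevant: "x \<in> F.span (B 0) \<Longrightarrow> r \<in> irrelevant_ideal scale Rg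
          \<Longrightarrow> eps (smul r x) = 0"
    and eps_degree: "x \<in> free_component Rg smul deg (B 0) j \<Longrightarrow> j \<noteq> 0 \<Longrightarrow> eps x = 0"
    and eps_surj: "eps ` F.span (B 0) = UNIV"
    and eps_exact: "{z \<in> F.span (B 0). eps z = 0} = d ` F.span (B (Suc 0))"


section \<open>Tor and regularity\<close>

definition irrelevant_times :: "('k::field \<Rightarrow> 'r::comm_ring_1 \<Rightarrow> 'r) \<Rightarrow> (nat \<Rightarrow> 'r set)
    \<Rightarrow> ('r \<Rightarrow> 'm::ab_group_add \<Rightarrow> 'm) \<Rightarrow> 'm set" where
  "irrelevant_times scale Rg smul =
     module.span smul {smul r x | r x. r \<in> irrelevant_ideal scale Rg}"

text \<open>
  \<open>Tor\<^sub>i(k, k)\<^sub>j\<close> is the component of homological degree \<open>i\<close> and internal degree \<open>j\<close> of the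
  homology of \<open>k \<otimes>\<^sub>R F = F / R\<^sub>+ F\<close>. Cycles and boundaries are represented by their preimages in \<open>F\<close>.
\<close>

definition tor_bd :: "('k::field \<Rightarrow> 'r::comm_ring_1 \<Rightarrow> 'r) \<Rightarrow> (nat \<Rightarrow> 'r set)
    \<Rightarrow> ('r \<Rightarrow> 'm::ab_group_add \<Rightarrow> 'm) \<Rightarrow> ('m \<Rightarrow> 'm) \<Rightarrow> 'm set" where
  "tor_bd scale Rg smul d = range d + irrelevant_times scale Rg smul"

definition tor :: "('k::field \<Rightarrow> 'r::comm_ring_1 \<Rightarrow> 'r) \<Rightarrow> (nat \<Rightarrow> 'r set)
    \<Rightarrow> ('r \<Rightarrow> 'm::ab_group_add \<Rightarrow> 'm) \<Rightarrow> (nat \<Rightarrow> 'm set) \<Rightarrow> ('m \<Rightarrow> int) \<Rightarrow> ('m \<Rightarrow> 'm)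
    \<Rightarrow> nat \<Rightarrow> int \<Rightarrow> 'm set set" where
  "tor scale Rg smul B deg d i j =
     image_mod {z \<in> free_component Rg smul deg (B i) j. d z \<in> irrelevant_times scale Rg smul}
       (tor_bd scale Rg smul d)"

text \<open>In \<^typ>\<open>ereal\<close> the supremum of the empty set is \<open>-\<infinity>\<close>, as required.\<close>

definition tor_top :: "('k::field \<Rightarrow> 'r::comm_ring_1 \<Rightarrow> 'r) \<Rightarrow> (nat \<Rightarrow> 'r set)
    \<Rightarrow> ('r \<Rightarrow> 'm::ab_group_add \<Rightarrow> 'm) \<Rightarrow> (nat \<Rightarrow> 'm set) \<Rightarrow> ('m \<Rightarrow> int) \<Rightarrow> ('m \<Rightarrow> 'm)
    \<Rightarrow> nat \<Rightarrow> ereal" where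
  "tor_top scale Rg smul B deg d i =
     (SUP j\<in>{j. tor scale Rg smul B deg d i j \<noteq> {tor_bd scale Rg smul d}}. ereal (of_int j))"

definition tor_reg :: "('k::field \<Rightarrow> 'r::comm_ring_1 \<Rightarrow> 'r) \<Rightarrow> (nat \<Rightarrow> 'r set)
    \<Rightarrow> ('r \<Rightarrow> 'm::ab_group_add \<Rightarrow> 'm) \<Rightarrow> (nat \<Rightarrow> 'm set) \<Rightarrow> ('m \<Rightarrow> int) \<Rightarrow> ('m \<Rightarrow> 'm)
    \<Rightarrow> nat \<Rightarrow> ereal" where
  "tor_reg scale Rg smul B deg d n =
     Max ((\<lambda>i. tor_top scale Rg smul B deg d i - ereal (real i)) ` {..n})"


section \<open>The Koszul complex\<close>

text \<open>
  Let \<open>x\<^sub>0, \<dots>, x\<^bsub>e-1\<^esub>\<close> be an ordered \<open>k\<close>-basis \<open>xs\<close> of \<open>R\<^sub>1\<close>. The exterior algebra over \<open>R\<close> on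
  \<open>R \<otimes>\<^sub>k R\<^sub>1(-1)\<close> is free over \<open>R\<close> on the elements
  \<open>e\<^sub>S = (1 \<otimes> x\<^bsub>s1\<^esub>) \<and> \<dots> \<and> (1 \<otimes> x\<^bsub>sp\<^esub>)\<close> for \<open>S = {s1 < \<dots> < sp} \<subseteq> {0, \<dots>, e-1}\<close>. An element is
  represented by its coefficient function \<open>nat set \<Rightarrow> 'r\<close>, which vanishes off the subsets of
  \<open>{..<e}\<close>; addition is pointwise. (The pointwise product of functions is not used.)
\<close>

definition koszul_carrier :: "'r::comm_ring_1 list \<Rightarrow> (nat set \<Rightarrow> 'r) set" where
  "koszul_carrier xs = {f. \<forall>S. f S \<noteq> 0 \<longrightarrow> S \<subseteq> {..<length xs}}"

definition koszul_component :: "(nat \<Rightarrow> 'r set) \<Rightarrow> 'r::comm_ring_1 list \<Rightarrow> nat \<Rightarrow> nat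
    \<Rightarrow> (nat set \<Rightarrow> 'r) set" where
  "koszul_component Rg xs i j =
     {f \<in> koszul_carrier xs. \<forall>S. f S \<noteq> 0 \<longrightarrow> card S = i \<and> i \<le> j \<and> f S \<in> Rg (j - i)}"

text \<open>
  \<open>e\<^sub>S \<and> e\<^sub>T = \<plusminus> e\<^bsub>S \<union> T\<^esub>\<close> for disjoint \<open>S\<close> and \<open>T\<close>, the sign being that of the permutation sorting
  \<open>S\<close> followed by \<open>T\<close>, and \<open>e\<^sub>S \<and> e\<^sub>T = 0\<close> otherwise.
\<close>

definition wedge_sign :: "nat set \<Rightarrow> nat set \<Rightarrow> 'r::comm_ring_1" where
  "wedge_sign S T = (- 1) ^ card {(s, t). s \<in> S \<and> t \<in> T \<and> t < s}"

definition wedge :: "(nat set \<Rightarrow> 'r::comm_ring_1) \<Rightarrow> (nat set \<Rightarrow> 'r) \<Rightarrow> nat set \<Rightarrow> 'r" where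
  "wedge f g U = (\<Sum>S\<in>Pow U. wedge_sign S (U - S) * f S * g (U - S))"

definition wedge_one :: "nat set \<Rightarrow> 'r::comm_ring_1" where
  "wedge_one S = (if S = {} then 1 else 0)"

text \<open>
  \<open>\<partial> e\<^sub>S = \<Sum>\<^bsub>s \<in> S\<^esub> \<plusminus> x\<^sub>s e\<^bsub>S - {s}\<^esub>\<close> with sign \<open>(-1)\<close> to the number of elements of \<open>S\<close> below \<open>s\<close>;
  below, this is read off at the coefficient of \<open>e\<^sub>T\<close>.
\<close>

definition koszul_diff :: "'r::comm_ring_1 list \<Rightarrow> (nat set \<Rightarrow> 'r) \<Rightarrow> nat set \<Rightarrow> 'r" where
  "koszul_diff xs f T =
     (\<Sum>s\<in>{..<length xs} - T. (- 1) ^ card {t \<in> T. t < s} * xs ! s * f (insert s T))"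

definition koszul_bd :: "'r::comm_ring_1 list \<Rightarrow> (nat set \<Rightarrow> 'r) set" where
  "koszul_bd xs = koszul_diff xs ` koszul_carrier xs"

text \<open>
  The algebra \<open>H(K)\<close> consists of the cosets \<open>z +o koszul_bd xs\<close> of cycles \<open>z\<close>; \<open>koszul_homology Rg xs i j\<close>
  is its component \<open>H\<^sub>i(K)\<^sub>j\<close>. Its addition is that of sets, its zero element is \<open>koszul_bd xs\<close>.
\<close>

definition koszul_homology :: "(nat \<Rightarrow> 'r set) \<Rightarrow> 'r::comm_ring_1 list \<Rightarrow> nat \<Rightarrow> nat
    \<Rightarrow> (nat set \<Rightarrow> 'r) set set" where
  "koszul_homology Rg xs i j =
     image_mod {z \<in> koszul_component Rg xs i j. koszul_diff xs z = 0} (koszul_bd xs)"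

definition homology_mult :: "'r::comm_ring_1 list \<Rightarrow> (nat set \<Rightarrow> 'r) set \<Rightarrow> (nat set \<Rightarrow> 'r) set
    \<Rightarrow> (nat set \<Rightarrow> 'r) set" where
  "homology_mult xs X Y = (\<Union>x\<in>X. \<Union>y\<in>Y. wedge x y +o koszul_bd xs)"

definition homology_one :: "'r::comm_ring_1 list \<Rightarrow> (nat set \<Rightarrow> 'r) set" where
  "homology_one xs = wedge_one +o koszul_bd xs"

definition homology_scale :: "('k::field \<Rightarrow> 'r::comm_ring_1 \<Rightarrow> 'r) \<Rightarrow> 'r list \<Rightarrow> 'k
    \<Rightarrow> (nat set \<Rightarrow> 'r) set \<Rightarrow> (nat set \<Rightarrow> 'r) set" where
  "homology_scale scale xs c X = (\<Union>x\<in>X. (\<lambda>S. scale c (x S)) +o koszul_bd xs)"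

fun homology_products :: "'r::comm_ring_1 list \<Rightarrow> (nat set \<Rightarrow> 'r) set set \<Rightarrow> nat
    \<Rightarrow> (nat set \<Rightarrow> 'r) set set" where
  "homology_products xs V 0 = {homology_one xs}"
| "homology_products xs V (Suc i) =
     {homology_mult xs X Y | X Y. X \<in> V \<and> Y \<in> homology_products xs V i}"

inductive_set homology_span :: "('k::field \<Rightarrow> 'r::comm_ring_1 \<Rightarrow> 'r) \<Rightarrow> 'r list
    \<Rightarrow> (nat set \<Rightarrow> 'r) set set \<Rightarrow> (nat set \<Rightarrow> 'r) set set"
  for scale :: "'k::field \<Rightarrow> 'r::comm_ring_1 \<Rightarrow> 'r" and xs :: "'r list"
    and G :: "(nat set \<Rightarrow> 'r) set set" where
  zero: "koszul_bd xs \<in> homology_span scale xs G"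
| base: "X \<in> G \<Longrightarrow> X \<in> homology_span scale xs G"
| add: "X \<in> homology_span scale xs G \<Longrightarrow> Y \<in> homology_span scale xs G
    \<Longrightarrow> X + Y \<in> homology_span scale xs G"
| scale: "X \<in> homology_span scale xs G \<Longrightarrow> homology_scale scale xs c X \<in> homology_span scale xs G"

definition homology_power :: "('k::field \<Rightarrow> 'r::comm_ring_1 \<Rightarrow> 'r) \<Rightarrow> 'r list
    \<Rightarrow> (nat set \<Rightarrow> 'r) set set \<Rightarrow> nat \<Rightarrow> (nat set \<Rightarrow> 'r) set set" where
  "homology_power scale xs V i = homology_span scale xs (homology_products xs V i)"

end

theory Submission
  imports Defs
begin

text \<open>
  Let \<open>F\<close> be a graded free resolution of \<open>k\<close> and \<open>K\<close> the Koszul complex. The theorem is read off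
  the double complex \<open>F \<otimes> K\<close>. As each \<open>K\<^sub>q\<close> is free, this complex is quasi-isomorphic to \<open>k \<otimes> K\<close>,
  whose component of homological degree \<open>q\<close> lies in internal degree \<open>q\<close>. In the spectral sequence of
  the filtration by the degree in \<open>F\<close>, a class of \<open>H\<^sub>q(K)\<^sub>j\<close> with \<open>j > q\<close> must therefore be
  killed by differentials out of subquotients of \<open>H\<^bsub>q+1-p\<^esub>(K) \<otimes> Tor\<^sub>p(k, k)\<close>, where \<open>p \<ge> 2\<close>: the ideal
  \<open>R\<^sub>+\<close> annihilates \<open>H(K)\<close>, so the second page is \<open>H(K) \<otimes> Tor(k, k)\<close>.

  By hypothesis \<open>Tor\<^sub>p(k, k)\<close> vanishes above degree \<open>p\<close>, and by induction \<open>H\<^bsub>q+1-p\<^esub>(K)\<close> vanishes above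
  degree \<open>2(q+1-p)\<close>. Hence \<open>j \<le> 2(q+1-p) + p = 2q + 2 - p \<le> 2q\<close>, which is the vanishing part. If
  \<open>j = 2q\<close>, then only \<open>p = 2\<close> contributes, and only through
  \<open>H\<^bsub>q-1\<^esub>(K)\<^bsub>2q-2\<^esub> \<otimes> Tor\<^sub>2(k, k)\<^sub>2\<close>. The differential \<open>d\<^sup>2\<close> is linear over \<open>H(K)\<close> and carries \<open>Tor\<^sub>2(k, k)\<^sub>2\<close>
  into \<open>H\<^sub>1(K)\<^sub>2\<close>, so \<open>H\<^sub>q(K)\<^bsub>2q\<^esub> = H\<^sub>1(K)\<^sub>2 \<cdot> H\<^bsub>q-1\<^esub>(K)\<^bsub>2q-2\<^esub>\<close>, and induction on \<open>q\<close> gives the power.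

  The proof below runs this argument with elements. An element of \<open>F \<otimes> K\<close> is a function from sets of
  indices to \<open>F\<close>. The passage to the second page, for a resolution that need not be minimal, is
  \<open>tor_linear_reduction\<close>; the zigzag through the double complex is \<open>homotope_to_syzygy_terms\<close>; the
  identification of \<open>d\<^sup>2\<close> with a product is part of \<open>cycle_decomposition\<close>.
\<close>

lemma sum_function_apply: "(\<Sum>i\<in>A. f i) x = (\<Sum>i\<in>A. f i x)"
  by (induction A rule: infinite_finite_induct) auto

lemma unit_sign_square: "(- 1) ^ n * (- 1) ^ n = (1 :: 'r::comm_ring_1)"
  by (simp flip: power_mult_distrib)

section \<open>Homogeneous parts and the residue map\<close>

context standard_graded_algebra
begin

lemma piece_zero [simp]: "0 \<in> Rg i"
  using subspace_piece subspace_0 by blast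

lemma piece_add: "x \<in> Rg i \<Longrightarrow> y \<in> Rg i \<Longrightarrow> x + y \<in> Rg i"
  using subspace_piece subspace_add by blast

lemma piece_scale: "x \<in> Rg i \<Longrightarrow> scale c x \<in> Rg i"
  using subspace_piece subspace_scale by blast

lemma scale_eq_mult: "scale c x = scale c 1 * x"
  using scale_mult[of c 1 x] by simp

definition hpart :: "nat \<Rightarrow> 'r \<Rightarrow> 'r" where
  "hpart i x = (THE f. (\<forall>i. f i \<in> Rg i) \<and> finite {i. f i \<noteq> 0} \<and> (\<Sum>i | f i \<noteq> 0. f i) = x) i"

lemma hpart_props:
  "hpart i x \<in> Rg i" "finite {i. hpart i x \<noteq> 0}" "(\<Sum>i | hpart i x \<noteq> 0. hpart i x) = x"
  using theI'[OF direct_sum[of x]] unfolding hpart_def by auto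

lemma hpart_sum:
  assumes "finite A" "{i. hpart i x \<noteq> 0} \<subseteq> A"
  shows "(\<Sum>i\<in>A. hpart i x) = x"
  using sum.mono_neutral_left[OF assms(1,2), of "\<lambda>i. hpart i x"] hpart_props(3)[of x] by auto

lemma hpart_unique:
  assumes "\<And>i. f i \<in> Rg i" "finite A" "\<And>i. f i \<noteq> 0 \<Longrightarrow> i \<in> A" "(\<Sum>i\<in>A. f i) = x"
  shows "hpart i x = f i"
proof -
  have s: "{i. f i \<noteq> 0} \<subseteq> A" using assms by auto
  have "(\<Sum>i | f i \<noteq> 0. f i) = x"
    using sum.mono_neutral_left[OF assms(2) s, of f] assms(4) by auto
  moreover have "finite {i. f i \<noteq> 0}" using s assms(2) finite_subset by blast
  ultimately have "(\<forall>i. f i \<in> Rg i) \<and> finite {i. f i \<noteq> 0} \<and> (\<Sum>i | f i \<noteq> 0. f i) = x"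
    using assms(1) by auto
  then have "(THE f. (\<forall>i. f i \<in> Rg i) \<and> finite {i. f i \<noteq> 0} \<and> (\<Sum>i | f i \<noteq> 0. f i) = x) = f"
    by (intro the1_equality[OF direct_sum[of x]])
  then show ?thesis unfolding hpart_def by simp
qed

lemma hpart_add: "hpart i (x + y) = hpart i x + hpart i y"
proof (rule hpart_unique[where f = "\<lambda>i. hpart i x + hpart i y"
      and A = "{i. hpart i x \<noteq> 0} \<union> {i. hpart i y \<noteq> 0}"])
  show "(\<Sum>i\<in>{i. hpart i x \<noteq> 0} \<union> {i. hpart i y \<noteq> 0}. hpart i x + hpart i y) = x + y"
    unfolding sum.distrib by (simp add: hpart_sum hpart_props)
qed (auto simp: hpart_props intro: piece_add)

lemma hpart_zero [simp]: "hpart i 0 = 0"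
  using hpart_add[of i 0 0] by simp

lemma hpart_homogeneous: "x \<in> Rg i \<Longrightarrow> hpart l x = (if l = i then x else 0)"
  by (rule hpart_unique[where f = "\<lambda>l. if l = i then x else 0" and A = "{i}"])
    (auto split: if_splits)

lemma hpart_mult:
  assumes "r \<in> Rg i"
  shows "hpart l (r * y) = (if l < i then 0 else r * hpart (l - i) y)"
proof (rule hpart_unique[where f = "\<lambda>l. if l < i then 0 else r * hpart (l - i) y"
      and A = "(\<lambda>m. m + i) ` {m. hpart m y \<noteq> 0}"])
  fix l show "(if l < i then 0 else r * hpart (l - i) y) \<in> Rg l"
    using piece_mult[OF assms hpart_props(1)[of "l - i" y]] by auto
next
  fix l assume "(if l < i then 0 else r * hpart (l - i) y) \<noteq> 0"
  then show "l \<in> (\<lambda>m. m + i) ` {m. hpart m y \<noteq> 0}"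
    by (intro image_eqI[of _ _ "l - i"]) (auto split: if_splits)
next
  have "(\<Sum>l\<in>(\<lambda>m. m + i) ` {m. hpart m y \<noteq> 0}. if l < i then 0 else r * hpart (l - i) y)
     = (\<Sum>m | hpart m y \<noteq> 0. r * hpart m y)"
    by (subst sum.reindex) (auto simp: inj_on_def)
  also have "\<dots> = r * y" by (simp add: hpart_props flip: sum_distrib_left)
  finally show "(\<Sum>l\<in>(\<lambda>m. m + i) ` {m. hpart m y \<noteq> 0}. if l < i then 0 else r * hpart (l - i) y)
     = r * y" .
qed (simp add: hpart_props)

abbreviation piece :: "int \<Rightarrow> 'r set" where
  "piece \<equiv> int_piece Rg"

lemma piece_nat: "piece (int i) = Rg i"
  by (simp add: int_piece_def)

lemma ipiece_negative: "m < 0 \<Longrightarrow> x \<in> piece m \<Longrightarrow> x = 0"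
  by (simp add: int_piece_def)

lemma ipiece_zero [simp]: "0 \<in> piece m"
  by (simp add: int_piece_def)

lemma ipiece_add: "x \<in> piece m \<Longrightarrow> y \<in> piece m \<Longrightarrow> x + y \<in> piece m"
  by (auto simp add: int_piece_def piece_add split: if_splits)

lemma ipiece_scale: "x \<in> piece m \<Longrightarrow> scale c x \<in> piece m"
  by (auto simp add: int_piece_def piece_scale split: if_splits)

lemma ipiece_uminus: "x \<in> piece m \<Longrightarrow> - x \<in> piece m"
  using ipiece_scale[of x m "-1"] by simp

lemma ipiece_sum: "(\<And>a. a \<in> A \<Longrightarrow> f a \<in> piece m) \<Longrightarrow> (\<Sum>a\<in>A. f a) \<in> piece m"
  by (induction A rule: infinite_finite_induct) (auto intro: ipiece_add)

lemma ipiece_mult: "x \<in> piece l \<Longrightarrow> y \<in> piece m \<Longrightarrow> x * y \<in> piece (l + m)"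
  using piece_mult[of x "nat l" y "nat m"]
  by (auto simp: int_piece_def nat_add_distrib split: if_splits)

lemma ipiece_sign: "x \<in> piece m \<Longrightarrow> (- 1) ^ l * x \<in> piece m"
  by (induction l) (auto intro: ipiece_uminus)

lemma one_in_piece: "1 \<in> piece 0"
  using piece_0 by (auto simp: int_piece_def intro!: image_eqI[of _ _ 1])

text \<open>
  Degrees are integers here because the generators of a resolution may have any integer as degree.
\<close>

definition ipart :: "int \<Rightarrow> 'r \<Rightarrow> 'r" where
  "ipart m x = (if m < 0 then 0 else hpart (nat m) x)"

lemma ipart_mem: "ipart m x \<in> piece m"
  by (simp add: ipart_def int_piece_def hpart_props)

lemma ipart_zero [simp]: "ipart m 0 = 0"
  by (simp add: ipart_def)

lemma ipart_add: "ipart m (x + y) = ipart m x + ipart m y"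
  by (simp add: ipart_def hpart_add)

lemma ipart_sum: "ipart m (\<Sum>a\<in>A. f a) = (\<Sum>a\<in>A. ipart m (f a))"
  by (induction A rule: infinite_finite_induct) (auto simp: ipart_add)

lemma ipart_homogeneous: "x \<in> piece l \<Longrightarrow> ipart m x = (if m = l then x else 0)"
  by (auto simp: ipart_def int_piece_def hpart_homogeneous nat_eq_iff split: if_splits)

lemma ipart_mult: "r \<in> piece i \<Longrightarrow> ipart m (r * y) = r * ipart (m - i) y"
  by (auto simp: ipart_def int_piece_def hpart_mult nat_diff_distrib split: if_splits)

lemma ipart_decomposition: "x = (\<Sum>i | hpart i x \<noteq> 0. ipart (int i) x)"
  by (simp add: ipart_def hpart_props)

text \<open>
  The augmentation \<open>R \<rightarrow> R / R\<^sub>+ = k\<close>, through which \<open>R\<close> acts on \<open>k\<close>. That it is multiplicative turns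
  statements modulo \<open>R\<^sub>+\<close> into equations in \<open>k\<close>.
\<close>

definition residue :: "'r \<Rightarrow> 'k" where
  "residue x = (SOME c. scale c 1 = hpart 0 x)"

lemma scale_residue: "scale (residue x) 1 = ipart 0 x"
proof -
  have "\<exists>c. scale c 1 = hpart 0 x" using hpart_props(1)[of 0 x] piece_0 by auto
  from someI_ex[OF this] show ?thesis by (simp add: residue_def ipart_def)
qed

lemma scale_one_inject: "scale c 1 = scale c' (1::'r) \<longleftrightarrow> c = c'"
  using scale_right_imp_eq[of "1::'r" c c'] by auto

lemma residue_eqI: "ipart 0 x = scale c 1 \<Longrightarrow> residue x = c"
  using scale_residue[of x] scale_one_inject by metis

lemma residue_eq_0_iff: "residue x = 0 \<longleftrightarrow> ipart 0 x = 0"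
  using scale_residue[of x] scale_one_inject[of "residue x" 0] by auto

lemma residue_add: "residue (x + y) = residue x + residue y"
  by (rule residue_eqI) (simp add: ipart_add scale_left_distrib scale_residue)

lemma residue_zero [simp]: "residue 0 = 0"
  by (rule residue_eqI) simp

lemma residue_sum: "residue (\<Sum>a\<in>A. f a) = (\<Sum>a\<in>A. residue (f a))"
  by (induction A rule: infinite_finite_induct) (auto simp: residue_add)

lemma scale_one_piece: "scale c 1 \<in> piece 0"
  using one_in_piece ipiece_scale by blast

lemma residue_scale: "residue (scale c x) = c * residue x"
proof (rule residue_eqI)
  have "ipart 0 (scale c x) = scale c 1 * ipart 0 x"
    using ipart_mult[OF scale_one_piece, of 0 c x] by (simp flip: scale_eq_mult)
  then show "ipart 0 (scale c x) = scale (c * residue x) 1"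
    by (simp flip: scale_eq_mult scale_residue)
qed

lemma residue_one [simp]: "residue 1 = 1"
  by (rule residue_eqI) (simp add: ipart_homogeneous[OF one_in_piece])

lemma residue_piece: "x \<in> piece m \<Longrightarrow> m \<noteq> 0 \<Longrightarrow> residue x = 0"
  by (simp add: residue_eq_0_iff ipart_homogeneous)

lemma piece_0_eq: "x \<in> piece 0 \<Longrightarrow> x = scale (residue x) 1"
  by (simp add: scale_residue ipart_homogeneous)

lemma residue_mult: "residue (x * y) = residue x * residue y"
proof -
  have "residue (ipart (int i) x * y) = residue (ipart (int i) x) * residue y" for i
  proof (cases "i = 0")
    case True
    have "ipart 0 x = scale (residue x) 1" by (simp add: scale_residue)
    then show ?thesis using True
      by (metis int_ops(1) residue_one residue_scale scale_eq_mult mult.right_neutral)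
  next
    case False
    have "ipart 0 (ipart (int i) x * y) = 0"
      using ipart_mult[OF ipart_mem, of 0 "int i" x y] False by (simp add: ipart_def)
    then have "residue (ipart (int i) x * y) = 0" by (simp add: residue_eq_0_iff)
    then show ?thesis using residue_piece[OF ipart_mem, of "int i" x] False by simp
  qed
  then have "residue ((\<Sum>i | hpart i x \<noteq> 0. ipart (int i) x) * y)
      = residue (\<Sum>i | hpart i x \<noteq> 0. ipart (int i) x) * residue y"
    by (simp add: sum_distrib_right residue_sum)
  then show ?thesis by (simp flip: ipart_decomposition)
qed

lemma irrelevant_ideal_eq: "irrelevant_ideal scale Rg = {r. residue r = 0}"
proof (intro equalityI subsetI)
  fix r assume "r \<in> irrelevant_ideal scale Rg"
  then have "r \<in> span (\<Union>i\<in>{1..}. Rg i)" by (simp add: irrelevant_ideal_def)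
  then show "r \<in> {r. residue r = 0}"
  proof (induction rule: span_induct_alt)
    case (step c x y)
    then obtain i where "i \<ge> 1" "x \<in> Rg i" by auto
    then have "residue x = 0" using residue_piece[of x "int i"] by (simp add: piece_nat)
    then show ?case using step by (simp add: residue_add residue_scale)
  qed simp
next
  fix r assume r: "r \<in> {r. residue r = 0}"
  have "ipart (int i) r \<in> span (\<Union>i\<in>{1..}. Rg i)" for i
  proof (cases "i = 0")
    case True
    then show ?thesis using r by (simp add: residue_eq_0_iff span_zero)
  next
    case False
    then show ?thesis using ipart_mem[of "int i" r]
      by (intro span_base) (auto simp: piece_nat)
  qed
  then have "(\<Sum>i | hpart i r \<noteq> 0. ipart (int i) r) \<in> span (\<Union>i\<in>{1..}. Rg i)"
    by (intro span_sum) auto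
  then show "r \<in> irrelevant_ideal scale Rg"
    by (simp add: irrelevant_ideal_def flip: ipart_decomposition)
qed

end

lemma square_one_cancel:
  fixes u v w :: "'r::comm_ring_1"
  assumes "v * v = 1" shows "(w * v) * (u * v) = w * u"
proof -
  have "(w * v) * (u * v) = w * u * (v * v)" by (simp only: mult_ac)
  then show ?thesis using assms by simp
qed

lemma regroup_left:
  fixes p q w :: "'r::comm_ring_1"
  assumes "p * q = w"
  shows "p * x * (q * y * z) = w * x * y * z"
  unfolding assms[symmetric] by (simp only: mult_ac)

section \<open>The Koszul complex as a differential graded algebra\<close>

abbreviation below_sign :: "nat \<Rightarrow> nat set \<Rightarrow> 'r::comm_ring_1" where
  "below_sign s T \<equiv> (- 1) ^ card {t \<in> T. t < s}"

lemma koszul_diff_add: "koszul_diff xs (f + g) = koszul_diff xs f + koszul_diff xs g"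
  by (simp add: koszul_diff_def fun_eq_iff distrib_left sum.distrib)

lemma koszul_diff_mult: "koszul_diff xs (\<lambda>S. r * f S) = (\<lambda>S. r * koszul_diff xs f S)"
  by (simp add: koszul_diff_def fun_eq_iff sum_distrib_left mult_ac)

lemma koszul_diff_zero [simp]: "koszul_diff xs 0 = 0"
  by (simp add: koszul_diff_def fun_eq_iff)

lemma koszul_diff_uminus: "koszul_diff xs (- f) = - koszul_diff xs f"
  by (simp add: koszul_diff_def fun_eq_iff sum_negf)

lemma koszul_diff_diff: "koszul_diff xs (f - g) = koszul_diff xs f - koszul_diff xs g"
  using koszul_diff_add[of xs f "- g"] by (simp add: koszul_diff_uminus)

lemma koszul_diff_sum: "koszul_diff xs (\<Sum>a\<in>A. f a) = (\<Sum>a\<in>A. koszul_diff xs (f a))"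
  by (rule ext, unfold koszul_diff_def sum_function_apply sum_distrib_left, rule sum.swap)

lemma koszul_carrier_iff: "f \<in> koszul_carrier xs \<longleftrightarrow> (\<forall>S. \<not> S \<subseteq> {..<length xs} \<longrightarrow> f S = 0)"
  by (auto simp: koszul_carrier_def)

lemma koszul_carrier_zero [simp]: "0 \<in> koszul_carrier xs"
  by (simp add: koszul_carrier_def)

lemma koszul_carrier_add: "f \<in> koszul_carrier xs \<Longrightarrow> g \<in> koszul_carrier xs \<Longrightarrow> f + g \<in> koszul_carrier xs"
  by (simp add: koszul_carrier_iff)

lemma koszul_carrier_mult: "f \<in> koszul_carrier xs \<Longrightarrow> (\<lambda>S. r * f S) \<in> koszul_carrier xs"
  by (simp add: koszul_carrier_iff)

lemma koszul_carrier_wedge: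
  assumes "f \<in> koszul_carrier xs" "g \<in> koszul_carrier xs"
  shows "wedge f g \<in> koszul_carrier xs"
  unfolding koszul_carrier_iff
proof (intro allI impI)
  fix U assume U: "\<not> U \<subseteq> {..<length xs}"
  have "f S = 0 \<or> g (U - S) = 0" for S
  proof -
    have "\<not> S \<subseteq> {..<length xs} \<or> \<not> U - S \<subseteq> {..<length xs}" using U by auto
    then show ?thesis using assms unfolding koszul_carrier_iff by blast
  qed
  then have "wedge_sign S (U - S) * f S * g (U - S) = 0" for S
    by (metis mult_zero_left mult_zero_right)
  then show "wedge f g U = 0" by (simp add: wedge_def)
qed

lemma koszul_carrier_diff:
  assumes "f \<in> koszul_carrier xs"
  shows "koszul_diff xs f \<in> koszul_carrier xs"
  unfolding koszul_carrier_iff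
proof (intro allI impI)
  fix U assume U: "\<not> U \<subseteq> {..<length xs}"
  then have "f (insert s U) = 0" for s
    using assms by (auto simp: koszul_carrier_iff)
  then show "koszul_diff xs f U = 0"
    by (simp add: koszul_diff_def)
qed

lemma wedge_add_left: "wedge (f + g) h = wedge f h + wedge g h"
  by (simp add: wedge_def fun_eq_iff algebra_simps sum.distrib)

lemma wedge_add_right: "wedge h (f + g) = wedge h f + wedge h g"
  by (simp add: wedge_def fun_eq_iff algebra_simps sum.distrib)

lemma wedge_zero_left [simp]: "wedge 0 h = 0"
  by (simp add: wedge_def fun_eq_iff)

lemma wedge_zero_right [simp]: "wedge h 0 = 0"
  by (simp add: wedge_def fun_eq_iff)

lemma wedge_mult_left: "wedge (\<lambda>S. r * f S) h = (\<lambda>S. r * wedge f h S)"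
  by (simp add: wedge_def fun_eq_iff sum_distrib_left mult_ac)

lemma wedge_mult_right: "wedge h (\<lambda>S. r * f S) = (\<lambda>S. r * wedge h f S)"
  by (simp add: wedge_def fun_eq_iff sum_distrib_left mult_ac)

lemma wedge_sum_left: "wedge (\<Sum>a\<in>A. f a) h = (\<Sum>a\<in>A. wedge (f a) h)"
  by (rule ext, unfold wedge_def sum_function_apply sum_distrib_left sum_distrib_right, rule sum.swap)

lemma below_sign_insert:
  assumes "finite T" "s \<notin> T"
  shows "(below_sign s' (insert s T) :: 'r::comm_ring_1) = (if s < s' then - 1 else 1) * below_sign s' T"
proof (cases "s < s'")
  case True
  then have "{t \<in> insert s T. t < s'} = insert s {t \<in> T. t < s'}" by auto
  then show ?thesis using assms True by (simp only: card_insert_disjoint) simp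
next
  case False
  then have "{t \<in> insert s T. t < s'} = {t \<in> T. t < s'}" by auto
  then show ?thesis using False by simp
qed

text \<open>
  The two orders of removing \<open>s\<close> and \<open>s'\<close> cancel in pairs. The sum is split by \<open>s' < s\<close> and
  \<open>s < s'\<close> rather than shown equal to its own negative, which would prove nothing in characteristic 2.
\<close>

lemma koszul_diff_square:
  fixes f :: "nat set \<Rightarrow> 'a::comm_ring_1"
  assumes "f \<in> koszul_carrier xs"
  shows "koszul_diff xs (koszul_diff xs f) = 0"
proof (rule ext)
  fix T
  show "koszul_diff xs (koszul_diff xs f) T = 0 T"
  proof (cases "T \<subseteq> {..<length xs}")
    case False
    then show ?thesis using koszul_carrier_diff[OF koszul_carrier_diff[OF assms]]
      by (simp add: koszul_carrier_iff)
  next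
    case True
    then have finT: "finite T" using finite_subset by auto
    define D where "D = {..<length xs} - T"
    define F where "F s s' = below_sign s T * below_sign s' T * (xs ! s * xs ! s') * f (insert s (insert s' T))" for s s'
    have D_insert: "{..<length xs} - insert s T = D - {s}" for s by (auto simp: D_def)
    have symF: "F s s' = F s' s" for s s' by (simp add: F_def mult_ac insert_commute)
    have "koszul_diff xs (koszul_diff xs f) T =
        (\<Sum>s\<in>D. below_sign s T * xs ! s * (\<Sum>s'\<in>D - {s}. below_sign s' (insert s T) * xs ! s' * f (insert s' (insert s T))))"
      unfolding koszul_diff_def D_def[symmetric] D_insert by (rule refl)
    also have "\<dots> = (\<Sum>s\<in>D. \<Sum>s'\<in>D. (if s' < s then F s s' else 0) - (if s < s' then F s s' else 0))"
    proof (intro sum.cong refl)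
      fix s assume s: "s \<in> D"
      have "below_sign s T * xs ! s * (\<Sum>s'\<in>D - {s}. below_sign s' (insert s T) * xs ! s' * f (insert s' (insert s T)))
          = (\<Sum>s'\<in>D - {s}. (if s' < s then F s s' else 0) - (if s < s' then F s s' else 0))"
        unfolding sum_distrib_left
      proof (intro sum.cong refl)
        fix s' assume s': "s' \<in> D - {s}"
        have b: "(below_sign s' (insert s T) :: 'a) = (if s < s' then - 1 else 1) * below_sign s' T"
          using s by (intro below_sign_insert finT) (simp add: D_def)
        have i: "insert s' (insert s T) = insert s (insert s' T)" by auto
        show "below_sign s T * xs ! s * (below_sign s' (insert s T) * xs ! s' * f (insert s' (insert s T)))
           = (if s' < s then F s s' else 0) - (if s < s' then F s s' else 0)"
          using s' unfolding b i F_def by (cases "s < s'") (simp_all add: mult_ac)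
      qed
      also have "\<dots> = (\<Sum>s'\<in>D. (if s' < s then F s s' else 0) - (if s < s' then F s s' else 0))"
        by (rule sum.mono_neutral_left) (auto simp: D_def)
      finally show "below_sign s T * xs ! s * (\<Sum>s'\<in>D - {s}. below_sign s' (insert s T) * xs ! s' * f (insert s' (insert s T)))
          = (\<Sum>s'\<in>D. (if s' < s then F s s' else 0) - (if s < s' then F s s' else 0))" .
    qed
    also have "\<dots> = (\<Sum>s\<in>D. \<Sum>s'\<in>D. if s' < s then F s s' else 0) - (\<Sum>s\<in>D. \<Sum>s'\<in>D. if s < s' then F s s' else 0)"
      by (simp add: sum_subtractf)
    also have "(\<Sum>s\<in>D. \<Sum>s'\<in>D. if s < s' then F s s' else 0) = (\<Sum>s\<in>D. \<Sum>s'\<in>D. if s' < s then F s s' else 0)"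
    proof (subst sum.swap, intro sum.cong refl)
      fix s s' show "(if s' < s then F s' s else 0) = (if s' < s then F s s' else 0)"
        using symF[of s' s] by (rule if_cong[OF refl _ refl])
    qed
    finally show ?thesis by simp
  qed
qed

lemma wedge_sign_insert_left:
  assumes "finite S" "finite U" "s \<notin> S"
  shows "(wedge_sign (insert s S) U :: 'r::comm_ring_1) = wedge_sign S U * below_sign s U"
proof -
  have "{(a, b). a \<in> insert s S \<and> b \<in> U \<and> b < a} = {(a, b). a \<in> S \<and> b \<in> U \<and> b < a} \<union> Pair s ` {t \<in> U. t < s}"
    by auto
  moreover have "card \<dots> = card {(a, b). a \<in> S \<and> b \<in> U \<and> b < a} + card (Pair s ` {t \<in> U. t < s})"
    using assms by (intro card_Un_disjoint) (auto intro: finite_subset[of _ "S \<times> U"])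
  ultimately show ?thesis
    unfolding wedge_sign_def by (simp only:) (simp add: power_add card_image inj_on_def)
qed

lemma wedge_sign_insert_right:
  assumes "finite S" "finite U" "s \<notin> U"
  shows "(wedge_sign S (insert s U) :: 'r::comm_ring_1) = wedge_sign S U * (- 1) ^ card {a \<in> S. s < a}"
proof -
  have "{(a, b). a \<in> S \<and> b \<in> insert s U \<and> b < a} = {(a, b). a \<in> S \<and> b \<in> U \<and> b < a} \<union> (\<lambda>a. (a, s)) ` {a \<in> S. s < a}"
    by auto
  moreover have "card \<dots> = card {(a, b). a \<in> S \<and> b \<in> U \<and> b < a} + card ((\<lambda>a. (a, s)) ` {a \<in> S. s < a})"
    using assms by (intro card_Un_disjoint) (auto intro: finite_subset[of _ "S \<times> U"])
  ultimately show ?thesis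
    unfolding wedge_sign_def by (simp only:) (simp add: power_add card_image inj_on_def)
qed

lemma below_sign_split:
  assumes "finite T" "S \<subseteq> T"
  shows "(below_sign s T :: 'r::comm_ring_1) = below_sign s S * below_sign s (T - S)"
proof -
  have "{t \<in> T. t < s} = {t \<in> S. t < s} \<union> {t \<in> T - S. t < s}" using assms by auto
  moreover have "card \<dots> = card {t \<in> S. t < s} + card {t \<in> T - S. t < s}"
    using assms finite_subset by (intro card_Un_disjoint) auto
  ultimately show ?thesis by (simp only: power_add)
qed

lemma above_sign:
  assumes "finite S" "s \<notin> S"
  shows "((- 1) ^ card {a \<in> S. s < a} :: 'r::comm_ring_1) = (- 1) ^ card S * below_sign s S"
proof -
  have "card ({a \<in> S. s < a} \<union> {t \<in> S. t < s}) = card {a \<in> S. s < a} + card {t \<in> S. t < s}"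
    using assms by (intro card_Un_disjoint) auto
  also have "{a \<in> S. s < a} \<union> {t \<in> S. t < s} = S"
    using assms by (auto simp: not_less_iff_gr_or_eq)
  finally have "((- 1) ^ card S :: 'r) = (- 1) ^ card {a \<in> S. s < a} * below_sign s S"
    by (simp only: power_add)
  then show ?thesis by (simp add: mult.assoc unit_sign_square)
qed

lemma sum_Pow_insert:
  assumes "finite T" "s \<notin> T"
  shows "(\<Sum>S\<in>Pow (insert s T). h S) = (\<Sum>S\<in>Pow T. h (insert s S)) + (\<Sum>S\<in>Pow T. h S)"
proof -
  have "(\<Sum>S\<in>insert s ` Pow T. h S) = (\<Sum>S\<in>Pow T. h (insert s S))"
    using assms(2) by (subst sum.reindex) (auto simp: inj_on_def)
  moreover have "Pow T \<inter> insert s ` Pow T = {}" using assms(2) by auto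
  ultimately show ?thesis
    using assms(1) by (simp add: Pow_insert sum.union_disjoint add.commute)
qed

text \<open>
  At the coefficient of \<open>e\<^sub>T\<close>, the left-hand side only involves indices outside \<open>T\<close>. On the right-hand
  side the indices \<open>s \<in> T\<close> occur as well, once in \<open>\<partial>f\<close> when \<open>s\<close> belongs to the second factor and once
  in \<open>\<partial>g\<close> when it belongs to the first; these terms cancel under moving \<open>s\<close> across.
\<close>

lemma leibniz:
  fixes f g :: "nat set \<Rightarrow> 'r::comm_ring_1"
  assumes f: "f \<in> koszul_carrier xs" and g: "g \<in> koszul_carrier xs"
  shows "koszul_diff xs (wedge f g)
    = wedge (koszul_diff xs f) g + wedge (\<lambda>S. (- 1) ^ card S * f S) (koszul_diff xs g)"
proof (rule ext)
  fix T
  let ?f = "\<lambda>S. (- 1) ^ card S * f S"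
  have f': "?f \<in> koszul_carrier xs" using f by (simp add: koszul_carrier_iff)
  show "koszul_diff xs (wedge f g) T = (wedge (koszul_diff xs f) g + wedge ?f (koszul_diff xs g)) T"
  proof (cases "T \<subseteq> {..<length xs}")
    case False
    moreover have "koszul_diff xs (wedge f g) \<in> koszul_carrier xs"
      "wedge (koszul_diff xs f) g + wedge ?f (koszul_diff xs g) \<in> koszul_carrier xs"
      using f g f' by (blast intro: koszul_carrier_add koszul_carrier_wedge koszul_carrier_diff)+
    ultimately show ?thesis by (simp add: koszul_carrier_iff)
  next
    case True
    then have finT: "finite T" using finite_subset by auto
    have fin: "finite S" if "S \<subseteq> T" for S using that finT finite_subset by auto
    define D where "D = {..<length xs} - T"
    define P where "P S s = wedge_sign S (T - S) * below_sign s S * xs ! s * f (insert s S) * g (T - S)" for S s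
    define Q where "Q S s = wedge_sign S (T - S) * (- 1) ^ card S * below_sign s (T - S) * xs ! s * f S * g (insert s (T - S))" for S s
    have "koszul_diff xs (wedge f g) T = (\<Sum>s\<in>D. \<Sum>S\<in>Pow T. P S s + Q S s)"
      unfolding koszul_diff_def D_def[symmetric]
    proof (intro sum.cong refl)
      fix s assume s: "s \<in> D"
      then have sT: "s \<notin> T" by (simp add: D_def)
      have "below_sign s T * xs ! s * wedge f g (insert s T) =
          (\<Sum>S\<in>Pow T. below_sign s T * xs ! s * (wedge_sign (insert s S) (insert s T - insert s S) * f (insert s S) * g (insert s T - insert s S)))
          + (\<Sum>S\<in>Pow T. below_sign s T * xs ! s * (wedge_sign S (insert s T - S) * f S * g (insert s T - S)))"
        by (simp add: wedge_def sum_Pow_insert[OF finT sT] distrib_left sum_distrib_left)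
      also have "\<dots> = (\<Sum>S\<in>Pow T. P S s) + (\<Sum>S\<in>Pow T. Q S s)"
      proof (intro arg_cong2[where f = "(+)"] sum.cong refl)
        fix S assume S: "S \<in> Pow T"
        have e1: "insert s T - insert s S = T - S" and e2: "insert s T - S = insert s (T - S)"
          using sT S by auto
        have n: "s \<notin> S" "s \<notin> T - S" using S sT by auto
        have split: "(below_sign s T :: 'r) = below_sign s S * below_sign s (T - S)"
          using S by (intro below_sign_split finT) auto
        have l: "(wedge_sign (insert s S) (T - S) :: 'r) = wedge_sign S (T - S) * below_sign s (T - S)"
          using S n finT fin by (intro wedge_sign_insert_left) auto
        have r: "(wedge_sign S (insert s (T - S)) :: 'r) = wedge_sign S (T - S) * ((- 1) ^ card S * below_sign s S)"
          using S n finT fin by (subst wedge_sign_insert_right) (auto simp: above_sign)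
        have "below_sign s T * wedge_sign (insert s S) (T - S) = wedge_sign S (T - S) * (below_sign s S :: 'r)"
          unfolding split l by (subst square_one_cancel) (simp_all add: unit_sign_square mult.commute)
        then show "below_sign s T * xs ! s * (wedge_sign (insert s S) (insert s T - insert s S) * f (insert s S) * g (insert s T - insert s S)) = P S s"
          unfolding e1 P_def by (rule regroup_left)
        have "below_sign s T * wedge_sign S (insert s (T - S)) = wedge_sign S (T - S) * (- 1) ^ card S * (below_sign s (T - S) :: 'r)"
          unfolding split r
          by (subst mult.commute[of "below_sign s S"], subst mult.assoc[of "wedge_sign S (T - S)", symmetric],
              subst square_one_cancel) (simp_all add: unit_sign_square mult_ac)
        then show "below_sign s T * xs ! s * (wedge_sign S (insert s T - S) * f S * g (insert s T - S)) = Q S s"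
          unfolding e2 Q_def by (rule regroup_left)
      qed
      finally show "below_sign s T * xs ! s * wedge f g (insert s T) = (\<Sum>S\<in>Pow T. P S s + Q S s)"
        by (simp add: sum.distrib)
    qed
    also have "\<dots> = (\<Sum>S\<in>Pow T. \<Sum>s\<in>D. P S s) + (\<Sum>S\<in>Pow T. \<Sum>s\<in>D. Q S s)"
      by (subst sum.swap) (simp add: sum.distrib)
    finally have L: "koszul_diff xs (wedge f g) T = (\<Sum>S\<in>Pow T. \<Sum>s\<in>D. P S s) + (\<Sum>S\<in>Pow T. \<Sum>s\<in>D. Q S s)" .
    have "wedge (koszul_diff xs f) g T = (\<Sum>S\<in>Pow T. \<Sum>s\<in>{..<length xs} - S. P S s)"
      by (simp add: wedge_def koszul_diff_def P_def sum_distrib_left sum_distrib_right mult_ac)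
    also have "\<dots> = (\<Sum>S\<in>Pow T. (\<Sum>s\<in>D. P S s) + (\<Sum>s\<in>T - S. P S s))"
    proof (intro sum.cong refl)
      fix S assume "S \<in> Pow T"
      then have "{..<length xs} - S = D \<union> (T - S)" using True by (auto simp: D_def)
      then show "(\<Sum>s\<in>{..<length xs} - S. P S s) = (\<Sum>s\<in>D. P S s) + (\<Sum>s\<in>T - S. P S s)"
        using finT by (simp, intro sum.union_disjoint) (auto simp: D_def)
    qed
    finally have R1: "wedge (koszul_diff xs f) g T = (\<Sum>S\<in>Pow T. \<Sum>s\<in>D. P S s) + (\<Sum>S\<in>Pow T. \<Sum>s\<in>T - S. P S s)"
      by (simp add: sum.distrib)
    have "wedge ?f (koszul_diff xs g) T = (\<Sum>S\<in>Pow T. \<Sum>s\<in>{..<length xs} - (T - S). Q S s)"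
      by (simp add: wedge_def koszul_diff_def Q_def sum_distrib_left sum_distrib_right mult_ac)
    also have "\<dots> = (\<Sum>S\<in>Pow T. (\<Sum>s\<in>D. Q S s) + (\<Sum>s\<in>S. Q S s))"
    proof (intro sum.cong refl)
      fix S assume S: "S \<in> Pow T"
      then have "{..<length xs} - (T - S) = D \<union> S" using True by (auto simp: D_def)
      then show "(\<Sum>s\<in>{..<length xs} - (T - S). Q S s) = (\<Sum>s\<in>D. Q S s) + (\<Sum>s\<in>S. Q S s)"
        using fin S by (simp, intro sum.union_disjoint) (auto simp: D_def)
    qed
    finally have R2: "wedge ?f (koszul_diff xs g) T = (\<Sum>S\<in>Pow T. \<Sum>s\<in>D. Q S s) + (\<Sum>S\<in>Pow T. \<Sum>s\<in>S. Q S s)"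
      by (simp add: sum.distrib)
    \<comment> \<open>The remaining terms have their index in T; moving it between the two factors changes the sign.\<close>
    have "(\<Sum>S\<in>Pow T. \<Sum>s\<in>S. Q S s) = (\<Sum>(S, s)\<in>Sigma (Pow T) (\<lambda>S. S). Q S s)"
      using finT fin by (intro sum.Sigma) auto
    also have "\<dots> = (\<Sum>(S, s)\<in>Sigma (Pow T) (\<lambda>S. T - S). - P S s)"
    proof (rule sum.reindex_bij_witness[where i = "\<lambda>(S, s). (insert s S, s)" and j = "\<lambda>(S, s). (S - {s}, s)"])
      fix p assume "p \<in> Sigma (Pow T) (\<lambda>S. S)"
      then obtain S s where p: "p = (insert s S, s)" "s \<notin> S" "insert s S \<subseteq> T"
        by (metis (no_types, lifting) Diff_iff PowD SigmaE insertI1 insert_Diff)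
      define U where "U = T - insert s S"
      have U: "T - S = insert s U" "s \<notin> U" "finite U" "finite S"
        using p finT fin by (auto simp: U_def)
      have a: "(wedge_sign (insert s S) U :: 'r) = wedge_sign S U * below_sign s U"
        using U p by (intro wedge_sign_insert_left) auto
      have b: "(wedge_sign S (insert s U) :: 'r) = wedge_sign S U * ((- 1) ^ card S * below_sign s S)"
        using U p by (subst wedge_sign_insert_right) (auto simp: above_sign)
      have "wedge_sign (insert s S) U * (- 1) ^ card (insert s S) * below_sign s U = (- (wedge_sign S U * (- 1) ^ card S) :: 'r)"
        unfolding a using U p square_one_cancel[OF unit_sign_square, where w = "wedge_sign S U" and u = "(- 1) ^ card S"]
        by (simp add: mult.assoc)
      moreover have "wedge_sign S (insert s U) * below_sign s S = (wedge_sign S U * (- 1) ^ card S :: 'r)"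
        unfolding b by (simp add: mult.assoc unit_sign_square)
      ultimately have sgn: "wedge_sign (insert s S) U * (- 1) ^ card (insert s S) * below_sign s U
          = (- (wedge_sign S (insert s U) * below_sign s S) :: 'r)" by simp
      have "Q (insert s S) s = (wedge_sign (insert s S) U * (- 1) ^ card (insert s S) * below_sign s U) * xs ! s * f (insert s S) * g (insert s U)"
        unfolding Q_def U_def[symmetric] by (rule refl)
      also have "\<dots> = - P S s"
        unfolding sgn P_def U(1) by simp
      finally have QP: "Q (insert s S) s = - P S s" .
      show "(case case p of (S, s) \<Rightarrow> (S - {s}, s) of (S, s) \<Rightarrow> - P S s) = (case p of (S, s) \<Rightarrow> Q S s)"
        using p(2) QP unfolding p(1) by simp
    qed auto
    also have "\<dots> = - (\<Sum>S\<in>Pow T. \<Sum>s\<in>T - S. P S s)"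
      using finT fin by (simp add: sum.Sigma[symmetric] sum_negf)
    finally show ?thesis using L R1 R2 by simp
  qed
qed

section \<open>Homogeneous Koszul forms\<close>

text \<open>
  Homogeneous elements of \<open>V \<otimes> K\<^sub>q\<close> with coefficients in \<open>V\<close>. Both the Koszul complex itself and its
  tensor product with a resolution have their graded pieces of this form.
\<close>

definition forms :: "nat \<Rightarrow> nat \<Rightarrow> 'x::zero set \<Rightarrow> (nat set \<Rightarrow> 'x) set" where
  "forms N q V = {f. \<forall>S. if S \<subseteq> {..<N} \<and> card S = q then f S \<in> V else f S = 0}"

lemma forms_compose:
  assumes "f \<in> forms N q V" "\<And>x. x \<in> V \<Longrightarrow> h x \<in> W" "h 0 = 0"
  shows "(\<lambda>S. h (f S)) \<in> forms N q W"
  using assms by (auto simp: forms_def)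

lemma forms_outside: "f \<in> forms N q V \<Longrightarrow> \<not> (S \<subseteq> {..<N} \<and> card S = q) \<Longrightarrow> f S = 0"
  by (auto simp: forms_def split: if_splits)

lemma forms_inside: "f \<in> forms N q V \<Longrightarrow> S \<subseteq> {..<N} \<Longrightarrow> card S = q \<Longrightarrow> f S \<in> V"
  by (auto simp: forms_def split: if_splits)

lemma forms_value: "f \<in> forms N q V \<Longrightarrow> 0 \<in> V \<Longrightarrow> f S \<in> V"
  by (auto simp: forms_def split: if_splits)

lemma formsI:
  "(\<And>S. S \<subseteq> {..<N} \<Longrightarrow> card S = q \<Longrightarrow> f S \<in> V) \<Longrightarrow>
   (\<And>S. \<not> (S \<subseteq> {..<N} \<and> card S = q) \<Longrightarrow> f S = 0) \<Longrightarrow> f \<in> forms N q V"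
  by (simp add: forms_def)

lemma forms_add:
  fixes V :: "'x::comm_monoid_add set"
  assumes "f \<in> forms N q V" "g \<in> forms N q V" "\<And>x y. x \<in> V \<Longrightarrow> y \<in> V \<Longrightarrow> x + y \<in> V"
  shows "f + g \<in> forms N q V"
  using assms(1,2) by (intro formsI) (auto simp: forms_inside forms_outside intro!: assms(3))

text \<open>
  The inclusion \<open>R = K\<^sub>0 \<subseteq> K\<close>.
\<close>

definition scalar_form :: "'r::comm_ring_1 \<Rightarrow> nat set \<Rightarrow> 'r" where
  "scalar_form r T = (if T = {} then r else 0)"

lemma wedge_scalar_form:
  assumes "f \<in> koszul_carrier xs"
  shows "wedge (scalar_form r) f = (\<lambda>S. r * f S)"
proof (rule ext)
  fix U
  show "wedge (scalar_form r) f U = r * f U"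
  proof (cases "finite U")
    case True
    have "wedge (scalar_form r) f U = (\<Sum>S\<in>{{}}. wedge_sign S (U - S) * scalar_form r S * f (U - S))"
      unfolding wedge_def using True
      by (intro sum.mono_neutral_right) (auto simp: scalar_form_def)
    then show ?thesis by (simp add: scalar_form_def wedge_sign_def)
  next
    case False
    then have "\<not> U \<subseteq> {..<length xs}" using finite_subset by blast
    then show ?thesis using False assms by (simp add: wedge_def koszul_carrier_iff)
  qed
qed

lemma koszul_bd_zero [simp]: "0 \<in> koszul_bd xs"
  unfolding koszul_bd_def by (rule image_eqI[of _ _ 0]) auto

lemma koszul_bd_iff: "f \<in> koszul_bd xs \<longleftrightarrow> (\<exists>k\<in>koszul_carrier xs. f = koszul_diff xs k)"
  by (auto simp: koszul_bd_def)

lemma koszul_bd_add: "f \<in> koszul_bd xs \<Longrightarrow> g \<in> koszul_bd xs \<Longrightarrow> f + g \<in> koszul_bd xs"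
  by (auto simp: koszul_bd_iff simp flip: koszul_diff_add intro: koszul_carrier_add)

lemma koszul_bd_mult: "f \<in> koszul_bd xs \<Longrightarrow> (\<lambda>S. r * f S) \<in> koszul_bd xs"
  by (auto simp: koszul_bd_iff simp flip: koszul_diff_mult intro: koszul_carrier_mult)

lemma koszul_bd_uminus: "f \<in> koszul_bd xs \<Longrightarrow> - f \<in> koszul_bd xs"
  using koszul_bd_mult[of f xs "- 1"] by (simp add: fun_Compl_def)

lemma koszul_bd_diff: "f \<in> koszul_bd xs \<Longrightarrow> g \<in> koszul_bd xs \<Longrightarrow> f - g \<in> koszul_bd xs"
  using koszul_bd_add[of f xs "- g"] koszul_bd_uminus[of g xs] by simp

lemma koszul_bd_sum: "(\<And>a. a \<in> A \<Longrightarrow> f a \<in> koszul_bd xs) \<Longrightarrow> (\<Sum>a\<in>A. f a) \<in> koszul_bd xs"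
proof (induction A rule: infinite_finite_induct)
  case (insert x F)
  then show ?case using koszul_bd_add[of "f x" xs "sum f F"] by (subst sum.insert) auto
qed (subst sum.infinite sum.empty, assumption?, rule koszul_bd_zero)+

lemma koszul_bd_cycle: "f \<in> koszul_bd xs \<Longrightarrow> koszul_diff xs f = 0"
  unfolding koszul_bd_def using koszul_diff_square by auto

lemma koszul_bd_carrier: "f \<in> koszul_bd xs \<Longrightarrow> f \<in> koszul_carrier xs"
  unfolding koszul_bd_def using koszul_carrier_diff by auto

text \<open>
  By the Leibniz rule the product of a boundary with a cycle is a boundary. The boundary
  may have mixed degrees, as the members of a homology class do.
\<close>

lemma wedge_bd_left:
  assumes "b \<in> koszul_bd xs" "z \<in> koszul_carrier xs" "koszul_diff xs z = 0"
  shows "wedge b z \<in> koszul_bd xs"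
proof -
  obtain k where k: "k \<in> koszul_carrier xs" "b = koszul_diff xs k"
    using assms(1) unfolding koszul_bd_def by blast
  have "koszul_diff xs (wedge k z) = wedge b z"
    using leibniz[OF k(1) assms(2)] k assms(3) by simp
  from this[symmetric] show ?thesis
    unfolding koszul_bd_iff using koszul_carrier_wedge[OF k(1) assms(2)] by blast
qed

locale graded_algebra_with_basis = standard_graded_algebra scale Rg
  for scale :: "'k::field \<Rightarrow> 'r::comm_ring_1 \<Rightarrow> 'r" and Rg :: "nat \<Rightarrow> 'r set" +
  fixes xs :: "'r list"
  assumes basis: "ordered_basis scale (Rg 1) xs"
begin

lemma variable_in_piece: "s < length xs \<Longrightarrow> xs ! s \<in> piece 1"
  using basis span_base[of "xs ! s" "set xs"]
  by (auto simp: ordered_basis_def int_piece_def)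

lemma coefficient_in_piece: "s < length xs \<Longrightarrow> (- 1) ^ l * xs ! s \<in> piece 1"
  using variable_in_piece ipiece_sign by blast

text \<open>
  The elements \<open>a + \<Sum> x\<^sub>s c\<^sub>s\<close> with \<open>a \<in> k\<close> form a subalgebra containing \<open>R\<^sub>1\<close>, hence are all of \<open>R\<close>,
  and the residue of such an element is \<open>a\<close>.
\<close>

lemma variables_generate_irrelevant:
  assumes "residue r = 0"
  shows "\<exists>c. r = (\<Sum>s<length xs. xs ! s * c s)"
proof -
  define S where "S = {x. \<exists>a c. x = scale a 1 + (\<Sum>s<length xs. xs ! s * c s)}"
  have SI: "scale a 1 + (\<Sum>s<length xs. xs ! s * c s) \<in> S" for a c
    unfolding S_def by blast
  have sub: "subspace S"
  proof (rule subspaceI)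
    show "0 \<in> S" using SI[of 0 "\<lambda>_. 0"] by simp
  next
    fix x y assume "x \<in> S" "y \<in> S"
    then obtain a c a' c' where "x = scale a 1 + (\<Sum>s<length xs. xs ! s * c s)"
      "y = scale a' 1 + (\<Sum>s<length xs. xs ! s * c' s)" unfolding S_def by blast
    then have "x + y = scale (a + a') 1 + (\<Sum>s<length xs. xs ! s * (c s + c' s))"
      by (simp add: algebra_simps sum.distrib scale_left_distrib)
    then show "x + y \<in> S" using SI by simp
  next
    fix b x assume "x \<in> S"
    then obtain a c where x: "x = scale a 1 + (\<Sum>s<length xs. xs ! s * c s)"
      unfolding S_def by blast
    have "scale b x = scale (b * a) 1 + (\<Sum>s<length xs. xs ! s * (scale b 1 * c s))"
      unfolding x scale_right_distrib scale_scale
      by (subst scale_eq_mult[of b "sum _ _"]) (simp add: sum_distrib_left mult_ac)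
    then show "scale b x \<in> S" using SI by simp
  qed
  have "S = UNIV"
  proof (rule generated_in_degree_1)
    show "subspace S" by (rule sub)
    show "1 \<in> S" using SI[of 1 "\<lambda>_. 0"] by simp
  next
    fix x y assume "x \<in> S" "y \<in> S"
    then obtain a c a' c' where xy: "x = scale a 1 + (\<Sum>s<length xs. xs ! s * c s)"
      "y = scale a' 1 + (\<Sum>s<length xs. xs ! s * c' s)" unfolding S_def by blast
    have "x * y = scale a 1 * scale a' 1 + (\<Sum>s<length xs. xs ! s * c s) * y
        + scale a 1 * (\<Sum>s<length xs. xs ! s * c' s)"
      unfolding xy by (simp add: algebra_simps)
    also have "scale a 1 * scale a' 1 = scale (a * a') (1::'r)"
      by (simp flip: scale_eq_mult)
    also have "scale (a * a') 1 + (\<Sum>s<length xs. xs ! s * c s) * y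
        + scale a 1 * (\<Sum>s<length xs. xs ! s * c' s)
      = scale (a * a') 1 + (\<Sum>s<length xs. xs ! s * (c s * y + scale a 1 * c' s))"
      by (simp add: distrib_left sum.distrib sum_distrib_left sum_distrib_right mult_ac)
    finally show "x * y \<in> S" using SI by simp
  next
    have "xs ! t \<in> S" if "t < length xs" for t
    proof -
      have "(\<Sum>s<length xs. xs ! s * (if s = t then 1 else 0)) = xs ! t"
        using that by (simp add: if_distrib[of "(*) _"] cong: if_cong)
      then show ?thesis using SI[of 0 "\<lambda>s. if s = t then 1 else 0"] by simp
    qed
    then have "set xs \<subseteq> S" by (auto simp: in_set_conv_nth)
    then have "span (set xs) \<subseteq> S" using sub by (rule span_minimal)
    then show "Rg 1 \<subseteq> S" using basis by (simp add: ordered_basis_def)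
  qed
  then obtain a c where r: "r = scale a 1 + (\<Sum>s<length xs. xs ! s * c s)"
    unfolding S_def by blast
  have "residue (xs ! s) = 0" if "s < length xs" for s
    using variable_in_piece[OF that] residue_piece by auto
  then have "residue r = a"
    unfolding r by (simp add: residue_add residue_scale residue_sum residue_mult)
  then show ?thesis using r assms by auto
qed

abbreviation KC :: "nat \<Rightarrow> int \<Rightarrow> (nat set \<Rightarrow> 'r) set" where
  "KC q j \<equiv> forms (length xs) q (piece (j - int q))"

lemma koszul_component_eq: "koszul_component Rg xs i j = KC i (int j)"
proof (intro equalityI subsetI)
  fix f assume f: "f \<in> koszul_component Rg xs i j"
  show "f \<in> KC i (int j)"
  proof (rule formsI)
    fix S assume S: "S \<subseteq> {..<length xs}" "card S = i"
    show "f S \<in> piece (int j - int i)"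
    proof (cases "f S = 0")
      case False
      then have "i \<le> j" "f S \<in> Rg (j - i)"
        using f by (auto simp: koszul_component_def)
      then show ?thesis by (simp add: piece_nat flip: of_nat_diff)
    qed simp
  qed (use f in \<open>auto simp: koszul_component_def koszul_carrier_def\<close>)
next
  fix f assume f: "f \<in> KC i (int j)"
  have "S \<subseteq> {..<length xs}" "card S = i" "i \<le> j" "f S \<in> Rg (j - i)" if "f S \<noteq> 0" for S
  proof -
    show 1: "S \<subseteq> {..<length xs}" "card S = i"
      using forms_outside[OF f, of S] that by auto
    have 2: "f S \<in> piece (int j - int i)" using forms_inside[OF f 1] .
    then show "i \<le> j" using ipiece_negative[of "int j - int i" "f S"] that by linarith
    then show "f S \<in> Rg (j - i)" using 2 by (simp add: piece_nat flip: of_nat_diff)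
  qed
  then show "f \<in> koszul_component Rg xs i j"
    by (simp add: koszul_component_def koszul_carrier_def)
qed

lemma KC_carrier: "f \<in> KC q j \<Longrightarrow> f \<in> koszul_carrier xs"
  unfolding koszul_carrier_iff using forms_outside[of f "length xs" q] by blast

lemma KC_zero [simp]: "0 \<in> KC q j"
  by (intro formsI) auto

lemma KC_add: "f \<in> KC q j \<Longrightarrow> g \<in> KC q j \<Longrightarrow> f + g \<in> KC q j"
  by (rule forms_add) (auto intro: ipiece_add)

lemma KC_mult: "r \<in> piece m \<Longrightarrow> f \<in> KC q j \<Longrightarrow> (\<lambda>S. r * f S) \<in> KC q (j + m)"
  by (rule forms_compose) (auto simp: algebra_simps dest: ipiece_mult)

lemma KC_scale: "f \<in> KC q j \<Longrightarrow> (\<lambda>S. scale c (f S)) \<in> KC q j"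
  by (rule forms_compose) (auto intro: ipiece_scale)

lemma KC_sum: "(\<And>a. a \<in> A \<Longrightarrow> f a \<in> KC q j) \<Longrightarrow> (\<Sum>a\<in>A. f a) \<in> KC q j"
proof (induction A rule: infinite_finite_induct)
  case (insert x F)
  then show ?case using KC_add[of "f x" q j "sum f F"] by (subst sum.insert) auto
qed (subst sum.infinite sum.empty, assumption?, rule KC_zero)+

lemma insert_form_index:
  assumes "s < length xs" "s \<notin> T"
  shows "insert s T \<subseteq> {..<length xs} \<and> card (insert s T) = Suc q \<longleftrightarrow> T \<subseteq> {..<length xs} \<and> card T = q"
proof (cases "T \<subseteq> {..<length xs}")
  case True
  then have "finite T" using finite_subset by blast
  then show ?thesis using assms True by auto
qed auto

lemma koszul_diff_KC:
  assumes "f \<in> KC (Suc q) j"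
  shows "koszul_diff xs f \<in> KC q j"
proof (rule formsI)
  fix T assume T: "T \<subseteq> {..<length xs}" "card T = q"
  have "(- 1) ^ card {t \<in> T. t < s} * xs ! s * f (insert s T) \<in> piece (j - int q)"
    if "s \<in> {..<length xs} - T" for s
  proof -
    have "f (insert s T) \<in> piece (j - int (Suc q))"
      using insert_form_index[of s T q] that T by (intro forms_inside[OF assms]) auto
    then have "(- 1) ^ card {t \<in> T. t < s} * xs ! s * f (insert s T) \<in> piece (1 + (j - int (Suc q)))"
      using that by (intro ipiece_mult coefficient_in_piece) auto
    then show ?thesis by simp
  qed
  then show "koszul_diff xs f T \<in> piece (j - int q)"
    unfolding koszul_diff_def by (rule ipiece_sum)
next
  fix T assume T: "\<not> (T \<subseteq> {..<length xs} \<and> card T = q)"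
  have "f (insert s T) = 0" if "s \<in> {..<length xs} - T" for s
    using insert_form_index[of s T q] that T by (intro forms_outside[OF assms]) auto
  then show "koszul_diff xs f T = 0"
    by (simp add: koszul_diff_def)
qed

lemma koszul_diff_KC_0:
  assumes "f \<in> KC 0 j"
  shows "koszul_diff xs f = 0"
proof (rule ext)
  fix T
  have "f (insert s T) = 0" if "s \<in> {..<length xs}" for s
  proof (rule forms_outside[OF assms], rule notI)
    assume "insert s T \<subseteq> {..<length xs} \<and> card (insert s T) = 0"
    then show False using finite_subset[of "insert s T" "{..<length xs}"] by auto
  qed
  then show "koszul_diff xs f T = 0 T" by (simp add: koszul_diff_def)
qed

lemma wedge_KC:
  assumes f: "f \<in> KC p i" and g: "g \<in> KC q j"
  shows "wedge f g \<in> KC (p + q) (i + j)"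
proof (rule formsI)
  fix U assume U: "U \<subseteq> {..<length xs}" "card U = p + q"
  have "wedge_sign S (U - S) * f S * g (U - S) \<in> piece (i + j - int (p + q))" for S
  proof -
    have "f S \<in> piece (i - int p)" "g (U - S) \<in> piece (j - int q)"
      using forms_value[OF f] forms_value[OF g] by auto
    then have "wedge_sign S (U - S) * (f S * g (U - S)) \<in> piece ((i - int p) + (j - int q))"
      unfolding wedge_sign_def by (intro ipiece_sign ipiece_mult)
    then show ?thesis by (simp add: algebra_simps)
  qed
  then show "wedge f g U \<in> piece (i + j - int (p + q))"
    unfolding wedge_def by (intro ipiece_sum)
next
  fix U assume U: "\<not> (U \<subseteq> {..<length xs} \<and> card U = p + q)"
  show "wedge f g U = 0"
  proof (cases "U \<subseteq> {..<length xs}")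
    case False
    then show ?thesis using koszul_carrier_wedge[OF KC_carrier[OF f] KC_carrier[OF g]]
      by (simp add: koszul_carrier_iff)
  next
    case True
    then have "finite U" using finite_subset by blast
    have "wedge_sign S (U - S) * f S * g (U - S) = 0" if "S \<in> Pow U" for S
    proof -
      have "card U = card S + card (U - S)"
        using that \<open>finite U\<close> by (simp add: card_Diff_subset card_mono finite_subset)
      then have "card S \<noteq> p \<or> card (U - S) \<noteq> q" using U True by auto
      then have "f S = 0 \<or> g (U - S) = 0" using forms_outside[OF f] forms_outside[OF g] by blast
      then show ?thesis by auto
    qed
    then show ?thesis unfolding wedge_def by (intro sum.neutral) auto
  qed
qed

text \<open>
  The projection onto \<open>K\<^sub>q\<close> in internal degree \<open>j\<close>. It commutes with the differential, so a
  homogeneous boundary is the boundary of a homogeneous element.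
\<close>

definition kpart :: "nat \<Rightarrow> int \<Rightarrow> (nat set \<Rightarrow> 'r) \<Rightarrow> nat set \<Rightarrow> 'r" where
  "kpart q j f S = (if S \<subseteq> {..<length xs} \<and> card S = q then ipart (j - int q) (f S) else 0)"

lemma kpart_KC: "kpart q j f \<in> KC q j"
  by (rule formsI) (auto simp: kpart_def ipart_mem)

lemma kpart_homogeneous:
  assumes "f \<in> KC q i"
  shows "kpart q j f = (if j = i then f else 0)"
proof (rule ext)
  fix S
  show "kpart q j f S = (if j = i then f else 0) S"
    using ipart_homogeneous[OF forms_value[OF assms ipiece_zero], of "j - int q" S]
      forms_outside[OF assms, of S] by (auto simp: kpart_def)
qed

lemma kpart_koszul_diff: "kpart q j (koszul_diff xs f) = koszul_diff xs (kpart (Suc q) j f)"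
proof (rule ext)
  fix T
  show "kpart q j (koszul_diff xs f) T = koszul_diff xs (kpart (Suc q) j f) T"
  proof (cases "T \<subseteq> {..<length xs} \<and> card T = q")
    case True
    have "ipart (j - int q) ((- 1) ^ card {t \<in> T. t < s} * xs ! s * f (insert s T))
        = (- 1) ^ card {t \<in> T. t < s} * xs ! s * kpart (Suc q) j f (insert s T)"
      if s: "s \<in> {..<length xs} - T" for s
    proof -
      have "insert s T \<subseteq> {..<length xs} \<and> card (insert s T) = Suc q"
        using insert_form_index[of s T q] that True by auto
      then have "kpart (Suc q) j f (insert s T) = ipart (j - int q - 1) (f (insert s T))"
        by (simp add: kpart_def algebra_simps)
      then show ?thesis using ipart_mult[OF coefficient_in_piece] s by auto
    qed
    then show ?thesis using True by (simp add: kpart_def[of q] koszul_diff_def ipart_sum)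
  next
    case False
    have "kpart (Suc q) j f (insert s T) = 0" if s: "s \<in> {..<length xs} - T" for s
      using insert_form_index[of s T q] that False by (auto simp: kpart_def)
    then have "koszul_diff xs (kpart (Suc q) j f) T = 0" by (simp add: koszul_diff_def)
    moreover have "kpart q j (koszul_diff xs f) T = 0" using False by (auto simp: kpart_def)
    ultimately show ?thesis by simp
  qed
qed

lemma koszul_bd_homogeneous:
  assumes "f \<in> KC q j" "f \<in> koszul_bd xs"
  shows "\<exists>v\<in>KC (Suc q) j. koszul_diff xs v = f"
proof -
  obtain g where "f = koszul_diff xs g" using assms(2) unfolding koszul_bd_def by blast
  then have "koszul_diff xs (kpart (Suc q) j g) = f"
    using kpart_homogeneous[OF assms(1), of j] by (simp flip: kpart_koszul_diff)
  then show ?thesis using kpart_KC by blast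
qed

lemma kpart_bd: "f \<in> koszul_bd xs \<Longrightarrow> kpart q j f \<in> koszul_bd xs"
  unfolding koszul_bd_iff using kpart_koszul_diff KC_carrier[OF kpart_KC] by blast

text \<open>
  \<open>R\<^sub>+ = \<partial>(K\<^sub>1)\<close>: the element \<open>\<Sum> x\<^sub>s c\<^sub>s\<close> is the boundary of \<open>\<Sum> c\<^sub>s e\<^sub>s\<close>.
\<close>

lemma irrelevant_is_boundary:
  assumes "residue r = 0"
  shows "\<exists>t\<in>koszul_carrier xs. koszul_diff xs t = scalar_form r"
proof -
  obtain c where c: "r = (\<Sum>s<length xs. xs ! s * c s)"
    using variables_generate_irrelevant[OF assms] by blast
  define t where "t S = (if S \<subseteq> {..<length xs} \<and> card S = 1 then c (the_elem S) else 0)" for S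
  have "koszul_diff xs t T = scalar_form r T" for T
  proof (cases "T = {}")
    case True
    then show ?thesis by (simp add: koszul_diff_def scalar_form_def c t_def)
  next
    case False
    have "t (insert s T) = 0" if s: "s \<in> {..<length xs} - T" for s
    proof -
      have "\<not> (T \<subseteq> {..<length xs} \<and> card T = 0)"
        using False finite_subset[of T "{..<length xs}"] by auto
      then show ?thesis
        using insert_form_index[of s T 0] that by (auto simp: t_def)
    qed
    then show ?thesis using False by (simp add: koszul_diff_def scalar_form_def)
  qed
  moreover have "t \<in> koszul_carrier xs" by (simp add: koszul_carrier_def t_def)
  ultimately show ?thesis by blast
qed

lemma irrelevant_is_boundary_homogeneous:
  assumes "residue r = 0" "r \<in> piece m"
  shows "\<exists>t\<in>KC 1 m. koszul_diff xs t = scalar_form r"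
proof -
  obtain t where t: "koszul_diff xs t = scalar_form r"
    using irrelevant_is_boundary[OF assms(1)] by blast
  have "scalar_form r \<in> KC 0 m"
    using assms(2) by (intro formsI) (auto simp: scalar_form_def)
  from koszul_bd_homogeneous[OF this] irrelevant_is_boundary[OF assms(1)] show ?thesis
    unfolding koszul_bd_iff by force
qed

text \<open>
  If \<open>r = \<partial>t\<close> and \<open>z\<close> is a cycle, then \<open>r z = \<partial>(t \<and> z)\<close>.
\<close>

lemma irrelevant_kills_homology:
  assumes "residue r = 0" "z \<in> koszul_carrier xs" "koszul_diff xs z = 0"
  shows "(\<lambda>S. r * z S) \<in> koszul_bd xs"
proof -
  have "scalar_form r \<in> koszul_bd xs"
    using irrelevant_is_boundary[OF assms(1)] unfolding koszul_bd_def by force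
  from wedge_bd_left[OF this assms(2,3)] show ?thesis
    by (simp add: wedge_scalar_form[OF assms(2)])
qed

lemma homology_acts_through_residue:
  assumes "z \<in> koszul_carrier xs" "koszul_diff xs z = 0"
  shows "(\<lambda>S. r * z S) - (\<lambda>S. scale (residue r) (z S)) \<in> koszul_bd xs"
proof -
  have "(\<lambda>S. r * z S) - (\<lambda>S. scale (residue r) (z S)) = (\<lambda>S. (r - scale (residue r) 1) * z S)"
    by (simp add: fun_eq_iff left_diff_distrib flip: scale_eq_mult)
  moreover have "residue (r - scale (residue r) 1) = 0"
    using residue_add[of "r - scale (residue r) 1" "scale (residue r) 1"] by (simp add: residue_scale)
  ultimately show ?thesis using irrelevant_kills_homology assms by simp
qed

end

section \<open>Coordinates in the resolution\<close>

locale koszul_resolution =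
  graded_free_resolution scale Rg smul B deg d eps + graded_algebra_with_basis scale Rg xs
  for scale :: "'k::field \<Rightarrow> 'r::comm_ring_1 \<Rightarrow> 'r" and Rg :: "nat \<Rightarrow> 'r set"
    and smul :: "'r \<Rightarrow> 'm::ab_group_add \<Rightarrow> 'm"
    and B :: "nat \<Rightarrow> 'm set" and deg :: "'m \<Rightarrow> int" and d :: "'m \<Rightarrow> 'm" and eps :: "'m \<Rightarrow> 'k"
    and xs :: "'r list"
begin

definition coef :: "'m \<Rightarrow> 'm \<Rightarrow> 'r" where
  "coef b f = F.representation (\<Union>i. B i) f b"

abbreviation supp :: "'m \<Rightarrow> 'm set" where
  "supp f \<equiv> {b. coef b f \<noteq> 0}"

lemma in_span_all: "f \<in> F.span (\<Union>i. B i)"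
  using spanning by simp

lemma coef_add: "coef b (f + g) = coef b f + coef b g"
  by (simp add: coef_def F.representation_add[OF independent in_span_all in_span_all])

lemma coef_smul: "coef b (smul r f) = r * coef b f"
  by (simp add: coef_def F.representation_scale[OF independent in_span_all])

lemma coef_zero [simp]: "coef b 0 = 0"
  by (simp add: coef_def F.representation_zero)

lemma coef_uminus: "coef b (- f) = - coef b f"
  using coef_add[of b f "- f"] by (simp add: eq_neg_iff_add_eq_0 add.commute)

lemma coef_sum: "coef b (\<Sum>a\<in>A. f a) = (\<Sum>a\<in>A. coef b (f a))"
  by (induction A rule: infinite_finite_induct) (auto simp: coef_add)

lemma coef_basis: "c \<in> B i \<Longrightarrow> coef b c = (if b = c then 1 else 0)"
  unfolding coef_def by (subst F.representation_basis[OF independent]) auto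

lemma finite_supp: "finite (supp f)"
  using F.finite_representation by (simp add: coef_def)

lemma supp_basis: "coef b f \<noteq> 0 \<Longrightarrow> \<exists>i. b \<in> B i"
  using F.representation_ne_zero[of "\<Union>i. B i" f b] by (simp add: coef_def)

lemma coef_expansion:
  assumes "finite A" "supp f \<subseteq> A"
  shows "(\<Sum>b\<in>A. smul (coef b f) b) = f"
proof -
  have "(\<Sum>b\<in>supp f. smul (coef b f) b) = f"
    using F.sum_nonzero_representation_eq[OF independent in_span_all, of f] by (simp add: coef_def)
  moreover have "(\<Sum>b\<in>supp f. smul (coef b f) b) = (\<Sum>b\<in>A. smul (coef b f) b)"
    using assms by (intro sum.mono_neutral_left) auto
  ultimately show ?thesis by simp
qed

lemma coef_eqI:
  assumes "\<And>b. coef b f = coef b g"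
  shows "f = g"
proof -
  have "f = (\<Sum>b\<in>supp f. smul (coef b f) b)" by (simp add: coef_expansion finite_supp)
  also have "\<dots> = (\<Sum>b\<in>supp g. smul (coef b g) b)" unfolding assms by (rule refl)
  also have "\<dots> = g" by (simp add: coef_expansion finite_supp)
  finally show ?thesis .
qed

lemma span_piece_iff: "f \<in> F.span (B i) \<longleftrightarrow> supp f \<subseteq> B i"
proof
  assume "f \<in> F.span (B i)"
  then show "supp f \<subseteq> B i"
  proof (induction rule: F.span_induct_alt)
    case (step c x y)
    have "coef b (smul c x + y) = 0" if "b \<notin> B i" for b
      using that step coef_basis[OF step(1), of b] by (auto simp: coef_add coef_smul)
    then show ?case by blast
  qed simp
next
  assume "supp f \<subseteq> B i"
  then have "(\<Sum>b\<in>supp f. smul (coef b f) b) \<in> F.span (B i)"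
    by (intro F.span_sum F.span_scale F.span_base) auto
  then show "f \<in> F.span (B i)" by (simp add: coef_expansion finite_supp)
qed

abbreviation FC :: "nat \<Rightarrow> int \<Rightarrow> 'm set" where
  "FC p j \<equiv> free_component Rg smul deg (B p) j"

lemma FC_iff: "f \<in> FC p j \<longleftrightarrow> (\<forall>b. coef b f \<in> piece (j - deg b)) \<and> (\<forall>b. b \<notin> B p \<longrightarrow> coef b f = 0)"
proof (intro iffI conjI allI impI)
  assume "f \<in> FC p j"
  then obtain A c where A: "f = (\<Sum>b\<in>A. smul (c b) b)" "finite A" "A \<subseteq> B p"
    "\<And>b. b \<in> A \<Longrightarrow> c b \<in> piece (j - deg b)"
    unfolding free_component_def by blast
  have "coef b f = (\<Sum>a\<in>A. if a = b then c a else 0)" for b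
    unfolding A(1) coef_sum using A(3) by (intro sum.cong refl) (auto simp: coef_smul coef_basis)
  then have c: "coef b f = (if b \<in> A then c b else 0)" for b using A(2) by simp
  show "coef b f \<in> piece (j - deg b)" for b using A(4) by (simp add: c)
  show "coef b f = 0" if "b \<notin> B p" for b using A(3) that by (auto simp: c)
next
  assume f: "(\<forall>b. coef b f \<in> piece (j - deg b)) \<and> (\<forall>b. b \<notin> B p \<longrightarrow> coef b f = 0)"
  have "f = (\<Sum>b\<in>supp f. smul (coef b f) b)" by (simp add: coef_expansion finite_supp)
  moreover have "finite (supp f) \<and> supp f \<subseteq> B p \<and> (\<forall>b\<in>supp f. coef b f \<in> piece (j - deg b))"
    using f finite_supp by auto
  ultimately show "f \<in> FC p j" unfolding free_component_def mem_Collect_eq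
    by (intro exI[of _ "supp f"] exI[of _ "\<lambda>b. coef b f"]) simp
qed

lemma FC_span: "f \<in> FC p j \<Longrightarrow> f \<in> F.span (B p)"
  by (auto simp: FC_iff span_piece_iff)

lemma FC_zero [simp]: "0 \<in> FC p j"
  by (simp add: FC_iff)

lemma FC_add: "f \<in> FC p j \<Longrightarrow> g \<in> FC p j \<Longrightarrow> f + g \<in> FC p j"
  by (auto simp: FC_iff coef_add intro: ipiece_add)

lemma FC_smul: "r \<in> piece m \<Longrightarrow> f \<in> FC p j \<Longrightarrow> smul r f \<in> FC p (j + m)"
proof -
  assume r: "r \<in> piece m" and f: "f \<in> FC p j"
  have "r * coef b f \<in> piece (m + (j - deg b))" for b
    using f by (intro ipiece_mult r) (simp add: FC_iff)
  then show ?thesis using f by (auto simp: FC_iff coef_smul algebra_simps)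
qed

lemma FC_uminus: "f \<in> FC p j \<Longrightarrow> - f \<in> FC p j"
  by (auto simp: FC_iff coef_uminus intro: ipiece_uminus)

lemma FC_basis: "b \<in> B p \<Longrightarrow> b \<in> FC p (deg b)"
  unfolding FC_iff by (auto simp: coef_basis[of b p] one_in_piece)

lemma d_add: "d (f + g) = d f + d g"
  using d_linear by (simp add: module_hom_iff)

lemma d_smul: "d (smul r f) = smul r (d f)"
  using d_linear by (simp add: module_hom_iff)

lemma d_zero [simp]: "d 0 = 0"
  using d_add[of 0 0] by simp

lemma d_uminus: "d (- f) = - d f"
  using d_add[of f "- f"] by (simp add: eq_neg_iff_add_eq_0 add.commute)

lemma d_diff: "d (f - g) = d f - d g"
  using d_add[of f "- g"] d_uminus by simp

lemma d_sum: "d (\<Sum>a\<in>A. f a) = (\<Sum>a\<in>A. d (f a))"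
  by (induction A rule: infinite_finite_induct) (auto simp: d_add)

text \<open>
  Every element is a sum of homogeneous ones; additive statements about the resolution may therefore
  be checked on the graded pieces, where the grading axioms apply.
\<close>

lemma homogeneous_induct [case_names zero add homogeneous]:
  assumes "Q 0" "\<And>f g. Q f \<Longrightarrow> Q g \<Longrightarrow> Q (f + g)" "\<And>p j f. f \<in> FC p j \<Longrightarrow> Q f"
  shows "Q f"
proof -
  have Qsum_degree: "Q (\<Sum>a\<in>A. h a)" if "\<And>a. a \<in> A \<Longrightarrow> Q (h a)" for A and h :: "nat \<Rightarrow> 'm"
    using that by (induction A rule: infinite_finite_induct) (auto intro: assms)
  have Qsum_basis: "Q (\<Sum>a\<in>A. h a)" if "\<And>a. a \<in> A \<Longrightarrow> Q (h a)" for A and h :: "'m \<Rightarrow> 'm"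
    using that by (induction A rule: infinite_finite_induct) (auto intro: assms)
  have "Q (smul r b)" if "b \<in> B p" for r b p
  proof -
    have "Q (\<Sum>i | hpart i r \<noteq> 0. smul (ipart (int i) r) b)"
    proof (rule Qsum_degree)
      fix i show "Q (smul (ipart (int i) r) b)"
        by (rule assms(3)[OF FC_smul[OF ipart_mem FC_basis[OF that]]])
    qed
    then show ?thesis by (simp flip: F.scale_sum_left ipart_decomposition)
  qed
  then have "Q (\<Sum>b\<in>supp f. smul (coef b f) b)"
    using supp_basis by (intro Qsum_basis) blast
  then show ?thesis by (simp add: coef_expansion finite_supp)
qed

lemma d_FC: "f \<in> FC (Suc p) j \<Longrightarrow> d f \<in> FC p j"
  by (rule d_component)

lemma d_square: "d (d f) = 0"
proof (induction f rule: homogeneous_induct)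
  case (homogeneous p j f)
  consider "p = 0" | "p = 1" | i where "p = Suc (Suc i)" by (metis One_nat_def not0_implies_Suc)
  then show ?case
  proof cases
    case 1
    then show ?thesis using d_0[OF FC_span] homogeneous by simp
  next
    case 2
    then show ?thesis using d_0[OF FC_span[OF d_FC]] homogeneous by simp
  next
    case 3
    then show ?thesis using d_exact[of i] FC_span homogeneous by blast
  qed
qed (auto simp: d_add)

text \<open>
  The projection onto the component of \<open>F\<^sub>p\<close> of internal degree \<open>j\<close>. It commutes with the differential,
  which makes exactness available degree by degree.
\<close>

definition fpart :: "nat \<Rightarrow> int \<Rightarrow> 'm \<Rightarrow> 'm" where
  "fpart p j f = (\<Sum>b\<in>supp f. if b \<in> B p then smul (ipart (j - deg b) (coef b f)) b else 0)"

lemma coef_fpart: "coef b (fpart p j f) = (if b \<in> B p then ipart (j - deg b) (coef b f) else 0)"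
proof -
  have "coef b (fpart p j f)
      = (\<Sum>c\<in>supp f. if c = b then if b \<in> B p then ipart (j - deg b) (coef b f) else 0 else 0)"
    unfolding fpart_def coef_sum by (intro sum.cong refl) (auto simp: coef_smul coef_basis)
  then show ?thesis using finite_supp[of f] by simp
qed

lemma fpart_FC: "fpart p j f \<in> FC p j"
  by (auto simp: FC_iff coef_fpart ipart_mem)

lemma fpart_add: "fpart p j (f + g) = fpart p j f + fpart p j g"
  by (rule coef_eqI) (simp add: coef_fpart coef_add ipart_add)

lemma fpart_zero [simp]: "fpart p j 0 = 0"
  by (rule coef_eqI) (simp add: coef_fpart)

lemma fpart_homogeneous:
  assumes "f \<in> FC p' j'"
  shows "fpart p j f = (if p = p' \<and> j = j' then f else 0)"
proof (rule coef_eqI)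
  fix b
  have 1: "ipart (j - deg b) (coef b f) = (if j - deg b = j' - deg b then coef b f else 0)"
    using assms by (intro ipart_homogeneous) (simp add: FC_iff)
  have 2: "coef b f = 0 \<or> b \<in> B p'" using assms by (simp add: FC_iff) blast
  have 3: "b \<in> B p \<Longrightarrow> b \<in> B p' \<Longrightarrow> p = p'" using disjoint[of p p'] by auto
  show "coef b (fpart p j f) = coef b (if p = p' \<and> j = j' then f else 0)"
    using 1 2 3 by (auto simp: coef_fpart)
qed

lemma d_fpart: "d (fpart (Suc p) j f) = fpart p j (d f)"
proof (induction f rule: homogeneous_induct)
  case (homogeneous p' j' f)
  show ?case
  proof (cases p')
    case 0
    then have "d f = 0" using d_0[OF FC_span] homogeneous by simp
    then show ?thesis using fpart_homogeneous[OF homogeneous] 0 by simp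
  next
    case (Suc i)
    then have "d f \<in> FC i j'" using homogeneous d_FC by simp
    then show ?thesis using fpart_homogeneous[OF homogeneous] fpart_homogeneous[of "d f" i j'] Suc by simp
  qed
qed (auto simp: d_add fpart_add)

lemma exact_homogeneous:
  assumes "f \<in> FC (Suc i) j" "d f = 0"
  shows "\<exists>g\<in>FC (Suc (Suc i)) j. d g = f"
proof -
  have "f \<in> d ` F.span (B (Suc (Suc i)))"
    using FC_span[OF assms(1)] assms(2) unfolding d_exact[of i, symmetric] by simp
  then obtain g where "d g = f" by blast
  then have "d (fpart (Suc (Suc i)) j g) = f" using fpart_homogeneous[OF assms(1)] by (simp add: d_fpart)
  then show ?thesis using fpart_FC by blast
qed

lemma eps_exact_homogeneous:
  assumes "f \<in> FC 0 j" "eps f = 0"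
  shows "\<exists>g\<in>FC 1 j. d g = f"
proof -
  have "f \<in> d ` F.span (B (Suc 0))"
    using FC_span[OF assms(1)] assms(2) unfolding eps_exact[symmetric] by simp
  then obtain g where "d g = f" by blast
  then have "d (fpart (Suc 0) j g) = f" using fpart_homogeneous[OF assms(1)] by (simp add: d_fpart)
  then show ?thesis using fpart_FC by (metis One_nat_def)
qed

text \<open>
  The submodule \<open>R\<^sub>+ F\<close>, in coordinates.
\<close>

definition irrelevant_submodule :: "'m set" where
  "irrelevant_submodule = {f. \<forall>b. residue (coef b f) = 0}"

lemma irrelevant_times_eq: "irrelevant_times scale Rg smul = irrelevant_submodule"
proof (intro equalityI subsetI)
  fix f assume "f \<in> irrelevant_times scale Rg smul"
  then have "f \<in> F.span {smul r x | r x. residue r = 0}"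
    by (simp add: irrelevant_times_def irrelevant_ideal_eq)
  then show "f \<in> irrelevant_submodule"
    by (induction rule: F.span_induct_alt)
      (auto simp: irrelevant_submodule_def coef_add coef_smul residue_add residue_mult)
next
  fix f assume "f \<in> irrelevant_submodule"
  then have "(\<Sum>b\<in>supp f. smul (coef b f) b) \<in> F.span {smul r x | r x. residue r = 0}"
    by (intro F.span_sum F.span_base) (auto simp: irrelevant_submodule_def)
  then show "f \<in> irrelevant_times scale Rg smul"
    by (simp add: irrelevant_times_def irrelevant_ideal_eq coef_expansion finite_supp)
qed

lemma residue_ipart: "residue x = 0 \<Longrightarrow> residue (ipart m x) = 0"
  using residue_piece[OF ipart_mem, of m x]
  by (cases "m = 0") (auto simp: residue_eq_0_iff ipart_homogeneous)

text \<open>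
  A cycle of \<open>F / R\<^sub>+ F\<close> in a degree where Tor vanishes is \<open>d y + r\<close> with \<open>r \<in> R\<^sub>+ F\<close>; discarding \<open>d y\<close>
  does not change its differential. Projecting to the given degree makes \<open>r\<close> homogeneous.
\<close>

lemma tor_vanishing:
  assumes tor: "tor scale Rg smul B deg d p j = {tor_bd scale Rg smul d}"
    and z: "z \<in> FC p j" "d z \<in> irrelevant_submodule"
  shows "\<exists>r\<in>FC p j. r \<in> irrelevant_submodule \<and> d r = d z"
proof -
  let ?N = "tor_bd scale Rg smul d"
  have "z +o ?N \<in> tor scale Rg smul B deg d p j"
    using z by (auto simp: tor_def image_mod_def irrelevant_times_eq)
  then have N: "z +o ?N = ?N" using tor by simp
  have "0 \<in> irrelevant_submodule" by (simp add: irrelevant_submodule_def)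
  then have "d 0 + 0 \<in> ?N"
    unfolding tor_bd_def irrelevant_times_eq by (intro set_plus_intro rangeI)
  then have "z + 0 \<in> z +o ?N" by (intro set_plus_intro2) simp
  then have "z \<in> ?N" using N by simp
  then obtain y t where y: "z = d y + t" "t \<in> irrelevant_submodule"
    unfolding tor_bd_def irrelevant_times_eq by (auto elim: set_plus_elim)
  have "fpart p j t \<in> irrelevant_submodule" using y(2) by (auto simp: irrelevant_submodule_def coef_fpart residue_ipart)
  moreover have "d (fpart p j t) = d z"
  proof -
    have "d (fpart p j (d y)) = 0"
    proof (cases p)
      case 0
      then show ?thesis using d_0[OF FC_span[OF fpart_FC]] by simp
    next
      case (Suc i)
      then show ?thesis by (simp add: d_fpart d_square)
    qed
    then show ?thesis
      using fpart_homogeneous[OF z(1), of p j] d_add[of "fpart p j (d y)" "fpart p j t"]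
      by (simp add: y(1) fpart_add)
  qed
  ultimately show ?thesis using fpart_FC by blast
qed

text \<open>
  An \<open>R\<close>-linear map \<open>F\<^sub>0 \<rightarrow> R\<close> covering the augmentation \<open>F\<^sub>0 \<rightarrow> k\<close>. It preserves degrees, since the
  augmentation is zero on basis elements of nonzero degree, and it sends \<open>d(F\<^sub>1)\<close> into \<open>R\<^sub>+\<close>.
\<close>

definition lift :: "'m \<Rightarrow> 'r" where
  "lift f = (\<Sum>b\<in>supp f \<inter> B 0. scale (eps b) (coef b f))"

lemma lift_superset:
  assumes "finite A" "supp f \<inter> B 0 \<subseteq> A" "A \<subseteq> B 0"
  shows "lift f = (\<Sum>b\<in>A. scale (eps b) (coef b f))"
  unfolding lift_def using assms by (intro sum.mono_neutral_left) auto

lemma lift_add: "lift (f + g) = lift f + lift g"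
proof -
  let ?A = "(supp f \<union> supp g) \<inter> B 0"
  have "lift h = (\<Sum>b\<in>?A. scale (eps b) (coef b h))" if "h \<in> {f, g, f + g}" for h
    using that finite_supp by (intro lift_superset) (auto simp: coef_add)
  then show ?thesis by (simp add: coef_add scale_right_distrib sum.distrib)
qed

lemma lift_smul: "lift (smul r f) = r * lift f"
proof -
  have "lift (smul r f) = (\<Sum>b\<in>supp f \<inter> B 0. scale (eps b) (coef b (smul r f)))"
    using finite_supp by (intro lift_superset) (auto simp: coef_smul)
  also have "\<dots> = r * lift f"
    unfolding lift_def sum_distrib_left coef_smul
    by (intro sum.cong refl) (metis mult.commute scale_mult)
  finally show ?thesis .
qed

lemma lift_zero [simp]: "lift 0 = 0"
  by (simp add: lift_def)

lemma lift_sum: "lift (\<Sum>a\<in>A. f a) = (\<Sum>a\<in>A. lift (f a))"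
  by (induction A rule: infinite_finite_induct) (auto simp: lift_add)

lemma lift_FC:
  assumes "f \<in> FC 0 j"
  shows "lift f \<in> piece j"
  unfolding lift_def
proof (rule ipiece_sum)
  fix b assume b: "b \<in> supp f \<inter> B 0"
  show "scale (eps b) (coef b f) \<in> piece j"
  proof (cases "deg b = 0")
    case True
    have "coef b f \<in> piece (j - deg b)" using assms by (simp add: FC_iff)
    then show ?thesis using True ipiece_scale by simp
  next
    case False
    then have "eps b = 0" using eps_degree[OF FC_basis] b by blast
    then show ?thesis by simp
  qed
qed

lemma eps_zero: "eps 0 = 0"
proof -
  have "eps (0 + 0) = eps 0 + eps 0" by (intro eps_add F.span_zero)
  then show ?thesis by (simp only: add_0_left add_cancel_right_right)
qed

lemma eps_smul:
  assumes "x \<in> F.span (B 0)"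
  shows "eps (smul r x) = residue r * eps x"
proof -
  let ?c = "scale (residue r) 1"
  have r: "residue (r - ?c) = 0"
    using residue_add[of "r - ?c" ?c] by (simp add: residue_scale)
  have "smul r x = smul ?c x + smul (r - ?c) x"
    by (simp flip: F.scale_left_distrib)
  then have "eps (smul r x) = eps (smul ?c x) + eps (smul (r - ?c) x)"
    using assms by (simp add: eps_add F.span_scale)
  then show ?thesis
    using eps_scale[OF assms] eps_irrelevant[OF assms, of "r - ?c"] r by (simp add: irrelevant_ideal_eq)
qed

lemma eps_eq_residue_lift:
  assumes "f \<in> F.span (B 0)"
  shows "eps f = residue (lift f)"
proof -
  have "f \<in> F.span (B 0) \<and> eps f = residue (lift f)"
  using assms
proof (induction rule: F.span_induct_alt)
  case (step c x y)
  have "lift x = scale (eps x) 1"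
    using step(1) lift_superset[of "{x}" x] by (auto simp: coef_basis)
  then have "residue (lift (smul c x)) = residue c * eps x"
    by (simp add: lift_smul residue_mult residue_scale)
  then show ?case
    using step by (simp add: eps_add eps_smul F.span_scale F.span_base F.span_add lift_add residue_add)
qed (simp add: eps_zero F.span_zero)
  then show ?thesis ..
qed

text \<open>
  A suitable multiple of a basis element of degree 0 on which the augmentation does not vanish.
\<close>

lemma unit_in_resolution: "\<exists>f\<in>FC 0 0. lift f = 1"
proof -
  obtain f where f: "f \<in> F.span (B 0)" "eps f = 1" using eps_surj by (metis UNIV_I imageE)
  have "\<exists>b\<in>B 0. eps b \<noteq> 0"
  proof (rule ccontr)
    assume "\<not> ?thesis"
    then have "lift f = 0" by (simp add: lift_def)
    then show False using f eps_eq_residue_lift by simp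
  qed
  then obtain b where b: "b \<in> B 0" "eps b \<noteq> 0" by blast
  then have "deg b = 0" using eps_degree[OF FC_basis] by blast
  then have "smul (scale (inverse (eps b)) 1) b \<in> FC 0 0"
    using FC_smul[OF scale_one_piece FC_basis[OF b(1)]] by simp
  moreover have "lift b = scale (eps b) 1"
    using b(1) lift_superset[of "{b}" b] by (auto simp: coef_basis)
  then have "lift (smul (scale (inverse (eps b)) 1) b) = 1"
    using b(2) by (simp add: lift_smul flip: scale_eq_mult)
  ultimately show ?thesis by blast
qed

section \<open>The double complex\<close>

abbreviation FK :: "nat \<Rightarrow> nat \<Rightarrow> int \<Rightarrow> (nat set \<Rightarrow> 'm) set" where
  "FK p q j \<equiv> forms (length xs) q (FC p (j - int q))"

text \<open>
  The Koszul differential on \<open>F \<otimes> K\<close>. It commutes with \<open>d\<close>, applied coefficientwise, so no sign is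
  introduced into the double complex.
\<close>

definition fdiff :: "(nat set \<Rightarrow> 'm) \<Rightarrow> nat set \<Rightarrow> 'm" where
  "fdiff w T = (\<Sum>s\<in>{..<length xs} - T. smul (below_sign s T * xs ! s) (w (insert s T)))"

lemma coef_fdiff: "coef b (fdiff w T) = koszul_diff xs (\<lambda>S. coef b (w S)) T"
  by (simp add: fdiff_def koszul_diff_def coef_sum coef_smul)

lemma d_fdiff: "d (fdiff w T) = fdiff (\<lambda>S. d (w S)) T"
  by (simp add: fdiff_def d_sum d_smul)

lemma fdiff_add: "fdiff (\<lambda>S. v S + w S) T = fdiff v T + fdiff w T"
  by (simp add: fdiff_def F.scale_right_distrib sum.distrib)

lemma FK_coef:
  assumes "w \<in> FK p q j"
  shows "(\<lambda>S. coef b (w S)) \<in> KC q (j - deg b)"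
proof (rule forms_compose[OF assms])
  fix x assume "x \<in> FC p (j - int q)"
  then have "coef b x \<in> piece (j - int q - deg b)" by (simp add: FC_iff)
  then show "coef b x \<in> piece (j - deg b - int q)" by (simp add: algebra_simps)
qed simp

lemma FK_supp: "w \<in> FK p q j \<Longrightarrow> supp (w S) \<subseteq> B p"
  using forms_value[of w "length xs" q "FC p (j - int q)" S] by (auto simp: FC_iff)

lemma FK_intro:
  assumes "\<And>b. (\<lambda>S. coef b (w S)) \<in> KC q (j - deg b)" "\<And>S. supp (w S) \<subseteq> B p"
  shows "w \<in> FK p q j"
proof (rule formsI)
  fix S assume S: "S \<subseteq> {..<length xs}" "card S = q"
  have "coef b (w S) \<in> piece (j - deg b - int q)" for b
    using forms_inside[OF assms(1) S] .
  then show "w S \<in> FC p (j - int q)" using assms(2)[of S] by (auto simp: FC_iff algebra_simps)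
next
  fix S assume S: "\<not> (S \<subseteq> {..<length xs} \<and> card S = q)"
  show "w S = 0" using forms_outside[OF assms(1) S] by (intro coef_eqI) simp
qed

lemma FK_zero [simp]: "0 \<in> FK p q j"
  by (intro formsI) auto

lemma FK_add: "v \<in> FK p q j \<Longrightarrow> w \<in> FK p q j \<Longrightarrow> v + w \<in> FK p q j"
  by (rule forms_add) (auto intro: FC_add)

lemma FK_uminus: "w \<in> FK p q j \<Longrightarrow> - w \<in> FK p q j"
  using forms_compose[of w _ q "FC p (j - int q)" uminus "FC p (j - int q)"] FC_uminus
  by (simp add: fun_Compl_def)

lemma FK_d: "w \<in> FK (Suc p) q j \<Longrightarrow> (\<lambda>S. d (w S)) \<in> FK p q j"
  by (rule forms_compose) (auto intro: d_FC)

lemma supp_fdiff: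
  assumes "\<And>S. supp (w S) \<subseteq> A"
  shows "supp (fdiff w T) \<subseteq> A"
proof -
  have "coef b (fdiff w T) = 0" if "b \<notin> A" for b
  proof -
    have "(\<lambda>S. coef b (w S)) = 0" using assms that by (auto simp: fun_eq_iff)
    then show ?thesis unfolding coef_fdiff by simp
  qed
  then show ?thesis by auto
qed

lemma fdiff_FK:
  assumes "w \<in> FK p (Suc q) j"
  shows "fdiff w \<in> FK p q j"
  using FK_coef[OF assms] FK_supp[OF assms]
  by (intro FK_intro supp_fdiff) (simp_all add: coef_fdiff koszul_diff_KC)

lemma fdiff_FK_0:
  assumes "w \<in> FK p 0 j"
  shows "fdiff w T = 0"
  by (rule coef_eqI) (simp add: coef_fdiff koszul_diff_KC_0[OF FK_coef[OF assms]])

lemma fdiff_square: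
  assumes "w \<in> FK p q j"
  shows "fdiff (fdiff w) T = 0"
  by (rule coef_eqI) (simp add: coef_fdiff koszul_diff_square[OF KC_carrier[OF FK_coef[OF assms]]])

lemma fdiff_tensor: "fdiff (\<lambda>S. smul (h S) u) T = smul (koszul_diff xs h T) u"
  by (simp add: fdiff_def koszul_diff_def F.scale_sum_left)

lemma tensor_FK:
  assumes "h \<in> KC q i" "u \<in> FC p (j - i)"
  shows "(\<lambda>S. smul (h S) u) \<in> FK p q j"
proof (rule forms_compose[OF assms(1)])
  fix x assume "x \<in> piece (i - int q)"
  from FC_smul[OF this assms(2)] show "smul x u \<in> FC p (j - int q)" by (simp add: algebra_simps)
qed simp

text \<open>
  Since \<open>K\<^sub>q\<close> is free, exactness of the resolution may be applied to each coefficient.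
\<close>

lemma FK_exact:
  assumes "w \<in> FK (Suc p) q j" "\<And>S. d (w S) = 0"
  shows "\<exists>v\<in>FK (Suc (Suc p)) q j. \<forall>S. d (v S) = w S"
proof -
  have "\<exists>g\<in>FC (Suc (Suc p)) (j - int q). d g = w S" for S
    using exact_homogeneous[OF forms_value[OF assms(1)]] assms(2) by simp
  then obtain g where g: "\<And>S. g S \<in> FC (Suc (Suc p)) (j - int q)" "\<And>S. d (g S) = w S" by metis
  define v where "v S = (if S \<subseteq> {..<length xs} \<and> card S = q then g S else 0)" for S
  have "v \<in> FK (Suc (Suc p)) q j" using g(1) by (intro formsI) (auto simp: v_def)
  moreover have "d (v S) = w S" for S
    using g(2) forms_outside[OF assms(1)] by (simp add: v_def)
  ultimately show ?thesis by blast
qed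

lemma FK_eps_exact:
  assumes "w \<in> FK 0 q j" "\<And>S. eps (w S) = 0"
  shows "\<exists>v\<in>FK 1 q j. \<forall>S. d (v S) = w S"
proof -
  have "\<exists>g\<in>FC 1 (j - int q). d g = w S" for S
    using eps_exact_homogeneous[OF forms_value[OF assms(1)]] assms(2) by simp
  then obtain g where g: "\<And>S. g S \<in> FC 1 (j - int q)" "\<And>S. d (g S) = w S" by metis
  define v where "v S = (if S \<subseteq> {..<length xs} \<and> card S = q then g S else 0)" for S
  have "v \<in> FK 1 q j" using g(1) by (intro formsI) (auto simp: v_def)
  moreover have "d (v S) = w S" for S
    using g(2) forms_outside[OF assms(1)] by (simp add: v_def)
  ultimately show ?thesis by blast
qed

end

context koszul_resolution
begin

lemma fdiff_fun_add: "fdiff (v + w) T = fdiff v T + fdiff w T"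
  by (simp add: fdiff_def F.scale_right_distrib sum.distrib)

lemma fdiff_fun_diff: "fdiff (v - w) T = fdiff v T - fdiff w T"
  by (simp add: fdiff_def F.scale_right_diff_distrib sum_subtractf)

lemma fdiff_fun_zero [simp]: "fdiff 0 T = 0"
  by (simp add: fdiff_def)

lemma fdiff_sum: "fdiff (\<lambda>S. \<Sum>a\<in>A. w a S) T = (\<Sum>a\<in>A. fdiff (w a) T)"
  unfolding fdiff_def F.scale_sum_right by (rule sum.swap)

lemma FK_sum:
  assumes "\<And>a. a \<in> A \<Longrightarrow> w a \<in> FK p q j"
  shows "(\<lambda>S. \<Sum>a\<in>A. w a S) \<in> FK p q j"
proof (rule formsI)
  fix S assume S: "S \<subseteq> {..<length xs}" "card S = q"
  have "w a S \<in> FC p (j - int q)" if "a \<in> A" for a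
    using forms_inside[OF assms[OF that] S] .
  then show "(\<Sum>a\<in>A. w a S) \<in> FC p (j - int q)"
    by (induction A rule: infinite_finite_induct) (auto intro: FC_add)
next
  fix S assume S: "\<not> (S \<subseteq> {..<length xs} \<and> card S = q)"
  have "w a S = 0" if "a \<in> A" for a
    using forms_outside[OF assms[OF that] S] .
  then show "(\<Sum>a\<in>A. w a S) = 0" by simp
qed

lemma FK_diff: "v \<in> FK p q j \<Longrightarrow> w \<in> FK p q j \<Longrightarrow> v - w \<in> FK p q j"
  using FK_add[of v q p j "- w"] FK_uminus[of w q p j] by simp

section \<open>Linear Tor and the second page\<close>

definition independent_classes :: "'i set \<Rightarrow> ('i \<Rightarrow> nat set \<Rightarrow> 'r) \<Rightarrow> bool" where
  "independent_classes A h \<longleftrightarrow>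
     (\<forall>c. (\<Sum>a\<in>A. (\<lambda>S. scale (c a) (h a S))) \<in> koszul_bd xs \<longrightarrow> (\<forall>a\<in>A. c a = 0))"

lemma independent_classes_not_bd:
  assumes "independent_classes A h" "finite A" "a \<in> A"
  shows "h a \<notin> koszul_bd xs"
proof
  assume "h a \<in> koszul_bd xs"
  moreover have "(\<Sum>a'\<in>A. (\<lambda>S. scale (if a' = a then 1 else 0) (h a' S))) = h a"
  proof (rule ext)
    fix S
    have "(\<Sum>a'\<in>A. scale (if a' = a then 1 else 0) (h a' S)) = (\<Sum>a'\<in>A. if a' = a then h a' S else 0)"
      by (intro sum.cong refl) auto
    then show "(\<Sum>a'\<in>A. (\<lambda>S. scale (if a' = a then 1 else 0) (h a' S))) S = h a S"
      using assms(2,3) by (simp add: sum_function_apply)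
  qed
  ultimately have "(\<Sum>a'\<in>A. (\<lambda>S. scale (if a' = a then 1 else 0) (h a' S))) \<in> koszul_bd xs"
    by (simp only:)
  from assms(1)[unfolded independent_classes_def, rule_format, OF this assms(3)]
  show False by simp
qed

lemma kpart_sum: "kpart q j (\<Sum>a\<in>A. f a) = (\<Sum>a\<in>A. kpart q j (f a))"
proof (rule ext)
  fix S show "kpart q j (\<Sum>a\<in>A. f a) S = (\<Sum>a\<in>A. kpart q j (f a)) S"
  proof (cases "S \<subseteq> {..<length xs} \<and> card S = q")
    case True
    then show ?thesis by (simp add: kpart_def sum_function_apply ipart_sum)
  next
    case False
    show ?thesis unfolding kpart_def sum_function_apply by (simp only: False if_False sum.neutral_const)
  qed
qed

text \<open>
  In a linear relation between homogeneous classes, the part in the degree of a class that occurs is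
  again a relation, and it may be solved for that class.
\<close>

lemma dependent_class_eliminated:
  assumes fin: "finite A" and h: "\<And>a. a \<in> A \<Longrightarrow> h a \<in> KC q (e a)"
    and dep: "\<not> independent_classes A h"
  shows "\<exists>a0\<in>A. \<exists>c. \<exists>v\<in>KC (Suc q) (e a0). (\<forall>a. c a \<noteq> 0 \<longrightarrow> e a = e a0) \<and>
           (\<forall>S. h a0 S = (\<Sum>a\<in>A - {a0}. scale (c a) (h a S)) + koszul_diff xs v S)"
proof -
  obtain c a0 where c: "(\<Sum>a\<in>A. (\<lambda>S. scale (c a) (h a S))) \<in> koszul_bd xs" and a0: "a0 \<in> A" "c a0 \<noteq> 0"
    using dep unfolding independent_classes_def by blast
  define c' where "c' a = (if e a = e a0 then - (c a / c a0) else 0)" for a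
  define g where "g S = h a0 S - (\<Sum>a\<in>A - {a0}. scale (c' a) (h a S))" for S
  have "scale (1 / c a0) (kpart q (e a0) (\<lambda>S. scale (c a) (h a S)) S) = - scale (c' a) (h a S)"
    if "a \<in> A" for a S
  proof -
    have "kpart q (e a0) (\<lambda>S. scale (c a) (h a S)) = (if e a0 = e a then (\<lambda>S. scale (c a) (h a S)) else 0)"
      by (rule kpart_homogeneous[OF KC_scale[OF h[OF that]]])
    then show ?thesis by (auto simp: c'_def)
  qed
  then have "scale (1 / c a0) (kpart q (e a0) (\<Sum>a\<in>A. (\<lambda>S. scale (c a) (h a S))) S)
      = (\<Sum>a\<in>A. - scale (c' a) (h a S))" for S
    unfolding kpart_sum sum_function_apply scale_sum_right by (intro sum.cong refl)
  moreover have "(\<Sum>a\<in>A. - scale (c' a) (h a S)) = g S" for S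
    using a0 by (simp add: sum.remove[OF fin a0(1)] g_def c'_def sum_negf)
  ultimately have g: "g = (\<lambda>S. scale (1 / c a0) 1 * kpart q (e a0) (\<Sum>a\<in>A. (\<lambda>S. scale (c a) (h a S))) S)"
    by (simp add: fun_eq_iff flip: scale_eq_mult)
  have "g \<in> koszul_bd xs" unfolding g by (intro koszul_bd_mult kpart_bd c)
  moreover have "g \<in> KC q (e a0)"
    unfolding g using KC_mult[OF scale_one_piece kpart_KC] by simp
  ultimately obtain v where v: "v \<in> KC (Suc q) (e a0)" "koszul_diff xs v = g"
    using koszul_bd_homogeneous by blast
  have "h a0 S = (\<Sum>a\<in>A - {a0}. scale (c' a) (h a S)) + koszul_diff xs v S" for S
    by (simp add: v g_def)
  moreover have "\<forall>a. c' a \<noteq> 0 \<longrightarrow> e a = e a0" by (simp add: c'_def)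
  ultimately show ?thesis using a0(1) v(1) by blast
qed

text \<open>
  Up to a Koszul boundary, an element \<open>\<Sum> h\<^sub>a \<otimes> u\<^sub>a\<close> can be rewritten so that the classes
  of the remaining \<open>h\<^sub>a\<close> are independent: a dependent \<open>h\<^sub>a\<close> is replaced by the others and its
  coefficient is distributed over theirs. Homogeneity is kept because only classes of the same degree
  are involved.
\<close>

lemma reduce_to_independent_classes:
  assumes "finite A" "\<And>a. a \<in> A \<Longrightarrow> h a \<in> KC q (e a)" "\<And>a. a \<in> A \<Longrightarrow> u a \<in> FC p (j - e a)"
  shows "\<exists>A'\<subseteq>A. \<exists>u'. \<exists>v\<in>FK p (Suc q) j. independent_classes A' h \<and> (\<forall>a\<in>A'. u' a \<in> FC p (j - e a)) \<and>
           (\<forall>S. (\<Sum>a\<in>A. smul (h a S) (u a)) = (\<Sum>a\<in>A'. smul (h a S) (u' a)) + fdiff v S)"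
  using assms
proof (induction A arbitrary: u rule: finite_psubset_induct)
  case (psubset A)
  show ?case
  proof (cases "independent_classes A h")
    case True
    have u: "\<forall>a\<in>A. u a \<in> FC p (j - e a)" using psubset.prems(2) by blast
    define v :: "nat set \<Rightarrow> 'm" where "v = 0"
    have v: "v \<in> FK p (Suc q) j" unfolding v_def by (rule FK_zero)
    have "\<forall>S. (\<Sum>a\<in>A. smul (h a S) (u a)) = (\<Sum>a\<in>A. smul (h a S) (u a)) + fdiff v S"
      unfolding v_def fdiff_fun_zero by simp
    with True u have "independent_classes A h \<and> (\<forall>a\<in>A. u a \<in> FC p (j - e a)) \<and>
        (\<forall>S. (\<Sum>a\<in>A. smul (h a S) (u a)) = (\<Sum>a\<in>A. smul (h a S) (u a)) + fdiff v S)" by (intro conjI)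
    then have "\<exists>v\<in>FK p (Suc q) j. independent_classes A h \<and> (\<forall>a\<in>A. u a \<in> FC p (j - e a)) \<and>
        (\<forall>S. (\<Sum>a\<in>A. smul (h a S) (u a)) = (\<Sum>a\<in>A. smul (h a S) (u a)) + fdiff v S)"
      using v by (rule bexI)
    then have "\<exists>u'. \<exists>v\<in>FK p (Suc q) j. independent_classes A h \<and> (\<forall>a\<in>A. u' a \<in> FC p (j - e a)) \<and>
        (\<forall>S. (\<Sum>a\<in>A. smul (h a S) (u a)) = (\<Sum>a\<in>A. smul (h a S) (u' a)) + fdiff v S)"
      by (rule exI[of _ u])
    then show ?thesis by (intro exI[of _ A] conjI order_refl)
  next
    case False
    obtain a0 c v0 where a0: "a0 \<in> A" and v0: "v0 \<in> KC (Suc q) (e a0)"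
      and c: "\<And>a. c a \<noteq> 0 \<Longrightarrow> e a = e a0"
      and h0: "\<And>S. h a0 S = (\<Sum>a\<in>A - {a0}. scale (c a) (h a S)) + koszul_diff xs v0 S"
      using dependent_class_eliminated[OF psubset.hyps psubset.prems(1) False] by blast
    define u1 where "u1 a = u a + smul (scale (c a) 1) (u a0)" for a
    have u1: "u1 a \<in> FC p (j - e a)" if "a \<in> A - {a0}" for a
    proof -
      have "smul (scale (c a) 1) (u a0) \<in> FC p (j - e a)"
      proof (cases "c a = 0")
        case False
        then have "e a = e a0" using c by blast
        then show ?thesis using FC_smul[OF scale_one_piece psubset.prems(2)[OF a0], of "c a"] by simp
      qed simp
      then show ?thesis using psubset.prems(2) that by (auto simp: u1_def intro: FC_add)
    qed
    have "A - {a0} \<subset> A" using a0 by auto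
    moreover have "h a \<in> KC q (e a)" if "a \<in> A - {a0}" for a
      using psubset.prems(1) that by simp
    ultimately have "\<exists>A'\<subseteq>A - {a0}. \<exists>u'. \<exists>v\<in>FK p (Suc q) j. independent_classes A' h \<and>
        (\<forall>a\<in>A'. u' a \<in> FC p (j - e a)) \<and>
        (\<forall>S. (\<Sum>a\<in>A - {a0}. smul (h a S) (u1 a)) = (\<Sum>a\<in>A'. smul (h a S) (u' a)) + fdiff v S)"
      using u1 by (rule psubset.IH)
    then obtain A' u' v where
      A': "A' \<subseteq> A - {a0}" and v: "v \<in> FK p (Suc q) j" and ind: "independent_classes A' h"
      and u': "\<forall>a\<in>A'. u' a \<in> FC p (j - e a)"
      and eq: "\<And>S. (\<Sum>a\<in>A - {a0}. smul (h a S) (u1 a)) = (\<Sum>a\<in>A'. smul (h a S) (u' a)) + fdiff v S"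
      by blast
    define v' where "v' = v + (\<lambda>S. smul (v0 S) (u a0))"
    have "v' \<in> FK p (Suc q) j"
      unfolding v'_def by (intro FK_add v tensor_FK[OF v0 psubset.prems(2)[OF a0]])
    moreover have "(\<Sum>a\<in>A. smul (h a S) (u a)) = (\<Sum>a\<in>A'. smul (h a S) (u' a)) + fdiff v' S" for S
    proof -
      have "smul (h a0 S) (u a0)
          = (\<Sum>a\<in>A - {a0}. smul (h a S) (smul (scale (c a) 1) (u a0))) + smul (koszul_diff xs v0 S) (u a0)"
      proof -
        have "smul (scale (c a) (h a S)) (u a0) = smul (h a S) (smul (scale (c a) 1) (u a0))" for a
          by (subst scale_eq_mult) (simp add: mult.commute)
        then show ?thesis
          unfolding h0 F.scale_left_distrib F.scale_sum_left by (simp cong: sum.cong)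
      qed
      moreover have "(\<Sum>a\<in>A. smul (h a S) (u a)) = smul (h a0 S) (u a0) + (\<Sum>a\<in>A - {a0}. smul (h a S) (u a))"
        by (rule sum.remove[OF psubset.hyps a0])
      ultimately have "(\<Sum>a\<in>A. smul (h a S) (u a))
          = (\<Sum>a\<in>A - {a0}. smul (h a S) (u1 a)) + smul (koszul_diff xs v0 S) (u a0)"
        by (simp add: u1_def F.scale_right_distrib sum.distrib algebra_simps)
      then show ?thesis by (simp add: eq v'_def fdiff_fun_add fdiff_tensor)
    qed
    ultimately have "\<exists>v\<in>FK p (Suc q) j. independent_classes A' h \<and> (\<forall>a\<in>A'. u' a \<in> FC p (j - e a)) \<and>
        (\<forall>S. (\<Sum>a\<in>A. smul (h a S) (u a)) = (\<Sum>a\<in>A'. smul (h a S) (u' a)) + fdiff v S)"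
      using ind u' by (intro bexI[of _ v']) simp_all
    moreover have "A' \<subseteq> A" using A' by blast
    ultimately show ?thesis 
      by - (rule exI[of _ A'], rule conjI, assumption, rule exI[of _ u'])
  qed
qed

text \<open>
  A coefficient acts on homology through its residue. If \<open>\<Sum> h\<^sub>a \<otimes> g\<^sub>a\<close> is a Koszul boundary, each
  coordinate gives a linear relation between the classes of the \<open>h\<^sub>a\<close> whose coefficients are the
  residues of the coordinates of the \<open>g\<^sub>a\<close>.
\<close>

lemma independent_coefficients_irrelevant:
  assumes ind: "independent_classes A h"
    and h: "\<And>a. a \<in> A \<Longrightarrow> h a \<in> KC q (e a)" "\<And>a. a \<in> A \<Longrightarrow> koszul_diff xs (h a) = 0"
    and x: "x \<in> FK p l j" "\<And>S. (\<Sum>a\<in>A. smul (h a S) (g a)) = fdiff x S"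
  shows "\<forall>a\<in>A. g a \<in> irrelevant_submodule"
proof -
  have "residue (coef b (g a)) = 0" if "a \<in> A" for a b
  proof -
    let ?f = "\<Sum>a\<in>A. (\<lambda>S. coef b (g a) * h a S)"
    let ?g = "\<Sum>a\<in>A. (\<lambda>S. scale (residue (coef b (g a))) (h a S))"
    have "?f = koszul_diff xs (\<lambda>S. coef b (x S))"
    proof (rule ext)
      fix S
      have "coef b (\<Sum>a\<in>A. smul (h a S) (g a)) = koszul_diff xs (\<lambda>S. coef b (x S)) S"
        unfolding x(2) by (rule coef_fdiff)
      then show "?f S = koszul_diff xs (\<lambda>S. coef b (x S)) S"
        by (simp add: coef_sum coef_smul sum_function_apply mult.commute)
    qed
    then have f: "?f \<in> koszul_bd xs"
      using KC_carrier[OF FK_coef[OF x(1)]] unfolding koszul_bd_def by blast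
    have "(\<Sum>a\<in>A. (\<lambda>S. coef b (g a) * h a S) - (\<lambda>S. scale (residue (coef b (g a))) (h a S))) \<in> koszul_bd xs"
      by (intro koszul_bd_sum homology_acts_through_residue KC_carrier[OF h(1)] h(2))
    then have "?f - ?g \<in> koszul_bd xs" by (simp only: sum_subtractf)
    from koszul_bd_diff[OF f this] have "?g \<in> koszul_bd xs" by simp
    from ind[unfolded independent_classes_def, rule_format, OF this that] show ?thesis .
  qed
  then show ?thesis by (simp add: irrelevant_submodule_def)
qed

lemma irrelevant_tensor_bd:
  assumes h: "h \<in> KC q i" "koszul_diff xs h = 0" and r: "r \<in> FC p (j - i)" "r \<in> irrelevant_submodule"
  shows "\<exists>v\<in>FK p (Suc q) j. \<forall>S. smul (h S) r = fdiff v S"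
proof -
  have "\<exists>t\<in>KC (Suc q) (j - deg b). koszul_diff xs t = (\<lambda>S. coef b r * h S)" for b
  proof (rule koszul_bd_homogeneous)
    have "coef b r \<in> piece (j - i - deg b)" using r(1) by (simp add: FC_iff)
    from KC_mult[OF this h(1)] show "(\<lambda>S. coef b r * h S) \<in> KC q (j - deg b)" by simp
    show "(\<lambda>S. coef b r * h S) \<in> koszul_bd xs"
      using r(2) by (intro irrelevant_kills_homology KC_carrier[OF h(1)] h(2)) (simp add: irrelevant_submodule_def)
  qed
  then obtain t where t: "\<And>b. t b \<in> KC (Suc q) (j - deg b)"
    "\<And>b. koszul_diff xs (t b) = (\<lambda>S. coef b r * h S)" by metis
  define v where "v S = (\<Sum>b\<in>supp r. smul (t b S) b)" for S
  have "v \<in> FK p (Suc q) j"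
    unfolding v_def
  proof (intro FK_sum tensor_FK[OF t(1)])
    fix b assume "b \<in> supp r"
    then have "b \<in> B p" using r(1) by (auto simp: FC_iff)
    from FC_basis[OF this] show "b \<in> FC p (j - (j - deg b))" by simp
  qed
  moreover have "smul (h S) r = fdiff v S" for S
  proof -
    have "fdiff v S = (\<Sum>b\<in>supp r. smul (h S) (smul (coef b r) b))"
      unfolding v_def fdiff_sum fdiff_tensor t(2) by (simp add: mult.commute)
    also have "\<dots> = smul (h S) r"
      by (subst F.scale_sum_right[symmetric]) (simp add: coef_expansion finite_supp)
    finally show ?thesis by simp
  qed
  ultimately show ?thesis by blast
qed

lemma finite_total_supp: "finite (\<Union>S\<in>Pow {..<length xs}. supp (w S))"
  using finite_supp by auto

lemma FK_expansion:
  assumes "w \<in> FK p q j" "finite A" "(\<Union>S\<in>Pow {..<length xs}. supp (w S)) \<subseteq> A"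
  shows "w S = (\<Sum>b\<in>A. smul (coef b (w S)) b)"
proof (cases "S \<subseteq> {..<length xs}")
  case True
  then have "supp (w S) \<subseteq> A" using assms(3) by blast
  then show ?thesis using coef_expansion[OF assms(2)] by simp
next
  case False
  then have "w S = 0" using forms_outside[OF assms(1)] by blast
  then show ?thesis by simp
qed

text \<open>
  This is the computation of the second page at \<open>(p+1, q)\<close>. A Koszul cycle \<open>y\<close> with values in
  \<open>F\<^bsub>p+1\<^esub>\<close> whose image under \<open>d\<close> is a Koszul boundary is, up to Koszul boundaries, a combination
  \<open>\<Sum> h\<^sub>a \<otimes> u\<^sub>a\<close> of classes of \<open>H\<^sub>q(K)\<close> with cycles \<open>u\<^sub>a\<close> of \<open>F / R\<^sub>+ F\<close>. The terms with \<open>u\<^sub>a\<close> in degree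
  above \<open>p + 1\<close>, where Tor vanishes, contribute only a Koszul boundary to \<open>d y\<close>.
\<close>

lemma tor_linear_reduction:
  assumes tor: "\<And>j. j > int (Suc p) \<Longrightarrow> tor scale Rg smul B deg d (Suc p) j = {tor_bd scale Rg smul d}"
    and y: "y \<in> FK (Suc p) q j" "\<And>S. fdiff y S = 0"
    and x: "x \<in> FK p (Suc q) j" "\<And>S. d (y S) = fdiff x S"
  shows "\<exists>A h e u. \<exists>v\<in>FK (Suc p) (Suc q) j. finite (A :: 'm set) \<and>
    (\<forall>a\<in>A. h a \<in> KC q (e a) \<and> koszul_diff xs (h a) = 0 \<and> h a \<notin> koszul_bd xs \<and>
       u a \<in> FC (Suc p) (j - e a) \<and> d (u a) \<in> irrelevant_submodule \<and> j - e a \<le> int (Suc p)) \<and>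
    (\<forall>S. d (y S) = (\<Sum>a\<in>A. smul (h a S) (d (u a))) + fdiff (\<lambda>S. d (v S)) S)"
proof -
  \<comment> \<open>Starting point: the coordinates of y are Koszul cycles.\<close>
  define A0 where "A0 = (\<Union>S\<in>Pow {..<length xs}. supp (y S))"
  define h where "h b S = coef b (y S)" for b S
  define e where "e b = j - deg b" for b
  have finA0: "finite A0" unfolding A0_def by (rule finite_total_supp)
  have A0B: "A0 \<subseteq> B (Suc p)" unfolding A0_def using FK_supp[OF y(1)] by blast
  have h: "h b \<in> KC q (e b)" for b unfolding h_def e_def by (rule FK_coef[OF y(1)])
  have hz: "koszul_diff xs (h b) = 0" for b
  proof (rule ext)
    fix T show "koszul_diff xs (h b) T = 0 T"
      using coef_fdiff[of b y T] y(2) by (simp add: h_def[abs_def])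
  qed
  have id: "b \<in> FC (Suc p) (j - e b)" if "b \<in> A0" for b
    using FC_basis[of b "Suc p"] that A0B by (auto simp: e_def)
  have "\<exists>A\<subseteq>A0. \<exists>u. \<exists>v\<in>FK (Suc p) (Suc q) j. independent_classes A h \<and> (\<forall>a\<in>A. u a \<in> FC (Suc p) (j - e a)) \<and>
      (\<forall>S. (\<Sum>b\<in>A0. smul (h b S) b) = (\<Sum>a\<in>A. smul (h a S) (u a)) + fdiff v S)"
    by (rule reduce_to_independent_classes[OF finA0, where u = "\<lambda>b. b"]) (rule h, erule id)
  then obtain A u v1 where A: "A \<subseteq> A0" and v1: "v1 \<in> FK (Suc p) (Suc q) j" and ind: "independent_classes A h"
    and u: "\<forall>a\<in>A. u a \<in> FC (Suc p) (j - e a)"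
    and eq: "\<And>S. (\<Sum>b\<in>A0. smul (h b S) b) = (\<Sum>a\<in>A. smul (h a S) (u a)) + fdiff v1 S"
    by (elim exE bexE conjE) (rule that, assumption+, simp)
  have finA: "finite A" using A finA0 finite_subset by blast
  have dy: "d (y S) = (\<Sum>a\<in>A. smul (h a S) (d (u a))) + fdiff (\<lambda>S. d (v1 S)) S" for S
  proof -
    have "y S = (\<Sum>a\<in>A. smul (h a S) (u a)) + fdiff v1 S"
      using FK_expansion[OF y(1) finA0, of S] eq[of S] by (simp add: A0_def h_def)
    then show ?thesis by (simp add: d_add d_sum d_smul d_fdiff)
  qed
  have "\<forall>a\<in>A. d (u a) \<in> irrelevant_submodule"
  proof (rule independent_coefficients_irrelevant[OF ind h hz])
    show "x - (\<lambda>S. d (v1 S)) \<in> FK p (Suc q) j" by (intro FK_diff x(1) FK_d v1)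
    show "(\<Sum>a\<in>A. smul (h a S) (d (u a))) = fdiff (x - (\<lambda>S. d (v1 S))) S" for S
      using dy[of S] by (simp add: x(2) fdiff_fun_diff)
  qed
  then have du_irrelevant: "d (u a) \<in> irrelevant_submodule" if "a \<in> A" for a using that by blast
  \<comment> \<open>The classes kept are those paired with a degree in which Tor need not vanish.\<close>
  define G where "G = {a\<in>A. j - e a \<le> int (Suc p)}"
  have "\<exists>v\<in>FK (Suc p) (Suc q) j. \<forall>S. smul (h a S) (d (u a)) = fdiff (\<lambda>S. d (v S)) S"
    if "a \<in> A - G" for a
  proof -
    have a: "a \<in> A" "j - e a > int (Suc p)" using that by (auto simp: G_def)
    obtain r where r: "r \<in> FC (Suc p) (j - e a)" "r \<in> irrelevant_submodule" "d r = d (u a)"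
      using tor_vanishing[OF tor[OF a(2)] _ du_irrelevant[OF a(1)]] u a(1) by blast
    obtain v where v: "v \<in> FK (Suc p) (Suc q) j" "\<And>S. smul (h a S) r = fdiff v S"
      using irrelevant_tensor_bd[OF h hz r(1,2)] by blast
    have "smul (h a S) (d (u a)) = fdiff (\<lambda>S. d (v S)) S" for S
      using v(2)[of S] by (simp flip: r(3) d_smul d_fdiff)
    then show ?thesis using v(1) by blast
  qed
  then obtain vb where vb: "\<And>a. a \<in> A - G \<Longrightarrow> vb a \<in> FK (Suc p) (Suc q) j"
    "\<And>a S. a \<in> A - G \<Longrightarrow> smul (h a S) (d (u a)) = fdiff (\<lambda>S. d (vb a S)) S" by metis
  define v where "v = v1 + (\<lambda>S. \<Sum>a\<in>A - G. vb a S)"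
  have "v \<in> FK (Suc p) (Suc q) j" unfolding v_def by (intro FK_add FK_sum v1 vb(1))
  moreover have "d (y S) = (\<Sum>a\<in>G. smul (h a S) (d (u a))) + fdiff (\<lambda>S. d (v S)) S" for S
  proof -
    have "(\<Sum>a\<in>A. smul (h a S) (d (u a)))
        = (\<Sum>a\<in>A - G. smul (h a S) (d (u a))) + (\<Sum>a\<in>G. smul (h a S) (d (u a)))"
      by (rule sum.subset_diff[OF _ finA]) (auto simp: G_def)
    also have "(\<Sum>a\<in>A - G. smul (h a S) (d (u a))) = fdiff (\<lambda>S. \<Sum>a\<in>A - G. d (vb a S)) S"
      unfolding fdiff_sum using vb(2) by (intro sum.cong refl)
    finally show ?thesis
      by (simp add: dy v_def d_add d_sum fdiff_add)
  qed
  moreover have "h a \<in> KC q (e a) \<and> koszul_diff xs (h a) = 0 \<and> h a \<notin> koszul_bd xs \<and>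
       u a \<in> FC (Suc p) (j - e a) \<and> d (u a) \<in> irrelevant_submodule \<and> j - e a \<le> int (Suc p)" if "a \<in> G" for a
    using that h hz u du_irrelevant independent_classes_not_bd[OF ind finA] by (auto simp: G_def)
  moreover have "finite G" using finA by (simp add: G_def)
  ultimately show ?thesis by blast
qed

end

section \<open>The zigzag through the double complex\<close>

locale linear_koszul_resolution = koszul_resolution scale Rg smul B deg d eps xs
  for scale :: "'k::field \<Rightarrow> 'r::comm_ring_1 \<Rightarrow> 'r" and Rg :: "nat \<Rightarrow> 'r set"
    and smul :: "'r \<Rightarrow> 'm::ab_group_add \<Rightarrow> 'm"
    and B :: "nat \<Rightarrow> 'm set" and deg :: "'m \<Rightarrow> int" and d :: "'m \<Rightarrow> 'm" and eps :: "'m \<Rightarrow> 'k"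
    and xs :: "'r list" +
  fixes n :: nat
  assumes tor_linear: "p \<le> Suc n \<Longrightarrow> j > int p \<Longrightarrow>
    tor scale Rg smul B deg d p j = {tor_bd scale Rg smul d}"
begin

text \<open>
  The data that survive for a cycle of homological degree \<open>q\<close> and internal degree \<open>j\<close>: elements of
  \<open>H\<^bsub>q-1\<^esub>(K)\<^bsub>2q-2\<^esub> \<otimes> Tor\<^sub>2(k, k)\<^sub>2\<close>, which can be present only if \<open>j = 2q\<close>.
\<close>

definition syzygy_terms :: "nat \<Rightarrow> int \<Rightarrow> 'm set \<Rightarrow> ('m \<Rightarrow> nat set \<Rightarrow> 'r) \<Rightarrow> ('m \<Rightarrow> 'm) \<Rightarrow> bool" where
  "syzygy_terms q j A h u \<longleftrightarrow> finite A \<and> (A \<noteq> {} \<longrightarrow> j = 2 * int q) \<and>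
     (\<forall>a\<in>A. h a \<in> KC (q - 1) (2 * int q - 2) \<and> koszul_diff xs (h a) = 0 \<and>
        u a \<in> FC 2 2 \<and> d (u a) \<in> irrelevant_submodule)"

text \<open>
  Without changing \<open>d w\<close>, the Koszul boundary of \<open>w\<close> can be made zero as long as its position is not
  \<open>p = 1\<close>, and at \<open>p = 1\<close> it can be made \<open>\<Sum> h\<^sub>a \<otimes> d u\<^sub>a\<close> with terms as above. The induction
  descends along the antidiagonal \<open>p = q + 1 - k\<close>, beginning at \<open>K\<^sub>0\<close>, where Koszul boundaries of
  elements vanish. In the step, the Koszul boundary of \<open>w\<close> is lifted along \<open>d\<close> to some \<open>y\<close>, which by
  the previous step may be taken to be a Koszul cycle; then \<open>y\<close> is reduced to the part with linear
  Tor, and the rest is subtracted from \<open>w\<close>.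
\<close>

lemma homotope_to_syzygy_terms:
  assumes q: "q \<le> n" "j \<ge> 2 * int q"
    and vanish: "\<forall>q'<q. \<forall>e>2 * int q'. \<forall>z\<in>KC q' e. koszul_diff xs z = 0 \<longrightarrow> z \<in> koszul_bd xs"
  shows "k \<le> q \<Longrightarrow> w \<in> FK (Suc q - k) k j \<Longrightarrow> (\<And>S. d (fdiff w S) = 0) \<Longrightarrow>
    \<exists>w'\<in>FK (Suc q - k) k j. \<exists>A h u. (\<forall>S. d (w' S) = d (w S)) \<and> syzygy_terms q j A h u \<and>
      (A \<noteq> {} \<longrightarrow> k = q) \<and> (\<forall>S. fdiff w' S = (\<Sum>a\<in>A. smul (h a S) (d (u a))))"
proof (induction k arbitrary: w)
  case 0
  have "fdiff w S = 0" for S using fdiff_FK_0[OF 0(2)] .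
  moreover have "syzygy_terms q j {} (\<lambda>a S. 0) (\<lambda>a. 0)" by (simp add: syzygy_terms_def)
  ultimately show ?case
    by (intro bexI[OF _ 0(2)] exI[of _ "{}"] exI[of _ "\<lambda>a S. 0"] exI[of _ "\<lambda>a. 0"]) simp
next
  case (Suc k)
  define p where "p = q - k"
  then have "p \<noteq> 0" using Suc.prems(1) by simp
  then obtain p' where p': "p = Suc p'" using not0_implies_Suc by blast
  have p: "Suc q - Suc k = p" "Suc q - k = Suc p" using Suc.prems(1) by (auto simp: p_def)
  have w: "w \<in> FK p (Suc k) j" using Suc.prems(2) unfolding p .
  obtain y0 where y0: "y0 \<in> FK (Suc p) k j" "\<And>S. d (y0 S) = fdiff w S"
    using FK_exact[of "fdiff w" k p' j] fdiff_FK[OF w] Suc.prems(3) unfolding p' by blast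
  have dy0: "d (fdiff y0 S) = 0" for S
    using fdiff_square[OF w] by (simp add: d_fdiff y0(2))
  have "k \<le> q" "y0 \<in> FK (Suc q - k) k j" using Suc.prems(1) y0(1) unfolding p by simp_all
  from Suc.IH[OF this dy0] obtain y and A0 :: "'m set" and h0 u0 where y: "y \<in> FK (Suc p) k j" "\<forall>S. d (y S) = d (y0 S)"
    and A0: "A0 \<noteq> {} \<longrightarrow> k = q" "\<forall>S. fdiff y S = (\<Sum>a\<in>A0. smul (h0 a S) (d (u0 a)))"
    unfolding p by (elim bexE exE conjE) (rule that, assumption+)
  have cycle: "fdiff y S = 0" for S using A0 Suc.prems(1) by auto
  have dy_w: "d (y S) = fdiff w S" for S using y(2) y0(2) by simp
  have tor: "tor scale Rg smul B deg d (Suc p) l = {tor_bd scale Rg smul d}" if "l > int (Suc p)" for l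
    using that q(1) by (intro tor_linear) (auto simp: p_def)
  have "\<exists>A h e u. \<exists>v\<in>FK (Suc p) (Suc k) j. finite (A :: 'm set) \<and>
    (\<forall>a\<in>A. h a \<in> KC k (e a) \<and> koszul_diff xs (h a) = 0 \<and> h a \<notin> koszul_bd xs \<and>
       u a \<in> FC (Suc p) (j - e a) \<and> d (u a) \<in> irrelevant_submodule \<and> j - e a \<le> int (Suc p)) \<and>
    (\<forall>S. d (y S) = (\<Sum>a\<in>A. smul (h a S) (d (u a))) + fdiff (\<lambda>S. d (v S)) S)"
    by (rule tor_linear_reduction[OF tor y(1) cycle w dy_w])
  then obtain A :: "'m set" and h e u v where v: "v \<in> FK (Suc p) (Suc k) j" and fin: "finite A" and
    A: "\<forall>a\<in>A. h a \<in> KC k (e a) \<and> koszul_diff xs (h a) = 0 \<and> h a \<notin> koszul_bd xs \<and>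
       u a \<in> FC (Suc p) (j - e a) \<and> d (u a) \<in> irrelevant_submodule \<and> j - e a \<le> int (Suc p)"
    and dy: "\<forall>S. d (y S) = (\<Sum>a\<in>A. smul (h a S) (d (u a))) + fdiff (\<lambda>S. d (v S)) S"
    by (elim bexE exE conjE) (rule that, assumption+)
  \<comment> \<open>The degree count: a surviving class has degree at most 2k, and its partner at most p + 1 = q - k + 1.\<close>
  have good: "j = 2 * int q \<and> Suc k = q \<and> p = 1 \<and> e a = 2 * int q - 2 \<and> j - e a = 2" if "a \<in> A" for a
  proof -
    have "\<not> e a > 2 * int k" using A that vanish Suc.prems(1) by (meson Suc_le_eq)
    moreover have "j - e a \<le> int (Suc p)" using A that by blast
    moreover have "int p = int q - int k" using Suc.prems(1) by (simp add: p_def)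
    ultimately show ?thesis using q(2) Suc.prems(1) by linarith
  qed
  have "syzygy_terms q j A h u"
    unfolding syzygy_terms_def
  proof (intro conjI impI ballI fin)
    show "j = 2 * int q" if "A \<noteq> {}" using good that by blast
    fix a assume a: "a \<in> A"
    have "q - 1 = k" "Suc p = 2" using good[OF a] by auto
    then show "h a \<in> KC (q - 1) (2 * int q - 2)" "u a \<in> FC 2 2" using A good[OF a] a by metis+
    show "koszul_diff xs (h a) = 0" "d (u a) \<in> irrelevant_submodule" using A a by blast+
  qed
  moreover have "A \<noteq> {} \<longrightarrow> Suc k = q" using good by blast
  moreover define w' where "w' = w - (\<lambda>S. d (v S))"
  have "w' \<in> FK p (Suc k) j" unfolding w'_def by (intro FK_diff w FK_d v)
  moreover have "\<forall>S. d (w' S) = d (w S)" by (simp add: w'_def d_diff d_square)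
  moreover have "\<forall>S. fdiff w' S = (\<Sum>a\<in>A. smul (h a S) (d (u a)))"
    using dy y(2) y0(2) by (simp add: w'_def fdiff_fun_diff)
  ultimately show ?case unfolding p by blast
qed

lemma residue_lift_d: "b \<in> B 1 \<Longrightarrow> residue (lift (d b)) = 0"
proof -
  assume "b \<in> B 1"
  then have "d b \<in> d ` F.span (B (Suc 0))" using F.span_base by auto
  then have "d b \<in> F.span (B 0)" "eps (d b) = 0" unfolding eps_exact[symmetric] by auto
  then show ?thesis using eps_eq_residue_lift by simp
qed

text \<open>
  For \<open>f\<^sub>0 \<in> F\<^sub>0\<close> lifting \<open>1 \<in> k\<close>, the element \<open>z \<otimes> f\<^sub>0\<close> is \<open>d w\<close>, because the coefficients of \<open>z\<close> lie
  in \<open>R\<^sub>+\<close>, and the Koszul boundary of \<open>w\<close> may be assumed to be \<open>\<Sum> h\<^sub>a \<otimes> d u\<^sub>a\<close>. Write the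
  coordinates \<open>r\<^bsub>ab\<^esub>\<close> of \<open>d u\<^sub>a \<in> R\<^sub>+ F\<^sub>1\<close> as \<open>\<partial>t\<^bsub>ab\<^esub>\<close>. Then the coordinates of \<open>w\<close> minus
  \<open>\<Sum> t\<^bsub>ab\<^esub> \<and> h\<^sub>a\<close> are cycles, and applying the map \<open>lift\<close> to \<open>d w = z \<otimes> f\<^sub>0\<close>
  multiplies them by elements of \<open>R\<^sub>+\<close>, so that they contribute boundaries. What remains of \<open>z\<close> is
  \<open>\<Sum> g\<^sub>a \<and> h\<^sub>a\<close>, where \<open>g\<^sub>a = \<Sum>\<^sub>b lift(d b) t\<^bsub>ab\<^esub>\<close> is a cycle because \<open>d (d u\<^sub>a) = 0\<close>.
\<close>

lemma cycle_decomposition: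
  assumes q: "1 \<le> q" "q \<le> n" "j \<ge> 2 * int q"
    and vanish: "\<forall>q'<q. \<forall>e>2 * int q'. \<forall>z\<in>KC q' e. koszul_diff xs z = 0 \<longrightarrow> z \<in> koszul_bd xs"
    and z: "z \<in> KC q j" "koszul_diff xs z = 0"
  shows "\<exists>A g h. finite (A :: 'm set) \<and> (A \<noteq> {} \<longrightarrow> j = 2 * int q) \<and>
    (\<forall>a\<in>A. g a \<in> KC 1 2 \<and> koszul_diff xs (g a) = 0 \<and>
       h a \<in> KC (q - 1) (2 * int q - 2) \<and> koszul_diff xs (h a) = 0) \<and>
    z - (\<Sum>a\<in>A. wedge (g a) (h a)) \<in> koszul_bd xs"
proof -
  obtain f0 where f0: "f0 \<in> FC 0 0" "lift f0 = 1" using unit_in_resolution by blast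
  have zf: "(\<lambda>S. smul (z S) f0) \<in> FK 0 q j"
    using f0(1) by (intro tensor_FK[OF z(1)]) simp
  have "eps (smul (z S) f0) = 0" for S
  proof -
    have "z S \<in> piece (j - int q)" by (rule forms_value[OF z(1)]) simp
    then have "residue (z S) = 0" using residue_piece q by force
    then show ?thesis using eps_smul[OF FC_span[OF f0(1)]] by simp
  qed
  then obtain w0 where w0: "w0 \<in> FK 1 q j" "\<And>S. d (w0 S) = smul (z S) f0"
    using FK_eps_exact[OF zf] by blast
  have "d (fdiff w0 S) = 0" for S
    by (simp add: d_fdiff w0(2) fdiff_tensor z(2))
  then have "\<exists>w'\<in>FK (Suc q - q) q j. \<exists>A h u. (\<forall>S. d (w' S) = d (w0 S)) \<and> syzygy_terms q j A h u \<and>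
      (A \<noteq> {} \<longrightarrow> q = q) \<and> (\<forall>S. fdiff w' S = (\<Sum>a\<in>A. smul (h a S) (d (u a))))"
    using w0(1) by (intro homotope_to_syzygy_terms[OF q(2,3) vanish]) simp_all
  then obtain w A h u where w: "w \<in> FK 1 q j" "\<And>S. d (w S) = smul (z S) f0"
    and A: "syzygy_terms q j A h u" and fw: "\<And>S. fdiff w S = (\<Sum>a\<in>A. smul (h a S) (d (u a)))"
    by (elim bexE exE conjE) (simp add: w0(2))
  have finA: "finite A" and Aj: "A \<noteq> {} \<longrightarrow> j = 2 * int q"
    and h: "\<And>a. a \<in> A \<Longrightarrow> h a \<in> KC (q - 1) (2 * int q - 2)" "\<And>a. a \<in> A \<Longrightarrow> koszul_diff xs (h a) = 0"
    and u: "\<And>a. a \<in> A \<Longrightarrow> u a \<in> FC 2 2" "\<And>a. a \<in> A \<Longrightarrow> d (u a) \<in> irrelevant_submodule"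
    using A unfolding syzygy_terms_def by blast+
  have hc: "h a \<in> koszul_carrier xs" if "a \<in> A" for a using KC_carrier[OF h(1)[OF that]] .
  have du: "d (u a) \<in> FC 1 2" if "a \<in> A" for a
    using d_FC[of "u a" 1 2] u(1)[OF that] by (simp add: numeral_2_eq_2)
  define E where "E b = lift (d b)" for b
  define r where "r a b = coef b (d (u a))" for a b
  define bs where "bs = (\<Union>S\<in>Pow {..<length xs}. supp (w S)) \<union> (\<Union>a\<in>A. supp (d (u a)))"
  have finbs: "finite bs" unfolding bs_def using finite_total_supp[of w] finA finite_supp by auto
  have bsB: "b \<in> B 1" if "b \<in> bs" for b
  proof -
    have "supp (d (u a)) \<subseteq> B 1" if "a \<in> A" for a
      using FC_span[OF du[OF that]] by (simp add: span_piece_iff)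
    then show ?thesis using that FK_supp[OF w(1)] unfolding bs_def by blast
  qed
  have E: "E b \<in> piece (deg b)" "residue (E b) = 0" if "b \<in> bs" for b
    using lift_FC[OF d_FC[of b 0 "deg b"]] FC_basis[OF bsB[OF that]] residue_lift_d[OF bsB[OF that]]
    by (simp_all add: E_def)
  have "\<exists>t\<in>KC 1 (2 - deg b). koszul_diff xs t = scalar_form (r a b)" if "a \<in> A" for a b
    using u(2)[OF that] du[OF that] unfolding r_def
    by (intro irrelevant_is_boundary_homogeneous) (simp_all add: irrelevant_submodule_def FC_iff)
  then obtain t where t: "\<And>a b. a \<in> A \<Longrightarrow> t a b \<in> KC 1 (2 - deg b)"
    "\<And>a b. a \<in> A \<Longrightarrow> koszul_diff xs (t a b) = scalar_form (r a b)" by metis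
  define wb where "wb b = (\<lambda>S. coef b (w S))" for b
  \<comment> \<open>Correcting the coordinates of w makes them Koszul cycles.\<close>
  define c where "c b = wb b - (\<Sum>a\<in>A. wedge (t a b) (h a))" for b
  have dt: "koszul_diff xs (wedge (t a b) (h a)) = (\<lambda>S. r a b * h a S)" if "a \<in> A" for a b
    using leibniz[OF KC_carrier[OF t(1)[OF that]] hc[OF that], of b]
    by (simp add: t(2)[OF that] h(2)[OF that] wedge_scalar_form[OF hc[OF that]])
  have dwb: "koszul_diff xs (wb b) = (\<Sum>a\<in>A. (\<lambda>S. r a b * h a S))" for b
  proof (rule ext)
    fix S
    have "koszul_diff xs (wb b) S = coef b (fdiff w S)" by (simp add: coef_fdiff wb_def)
    then show "koszul_diff xs (wb b) S = (\<Sum>a\<in>A. (\<lambda>S. r a b * h a S)) S"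
      by (simp add: fw coef_sum coef_smul sum_function_apply r_def mult.commute)
  qed
  have dc: "koszul_diff xs (c b) = 0" for b
    unfolding c_def koszul_diff_diff koszul_diff_sum dwb using dt by (simp cong: sum.cong)
  have cc: "c b \<in> koszul_carrier xs" for b
  proof -
    have "(\<Sum>a\<in>A. wedge (t a b) (h a)) \<in> KC (1 + (q - 1)) (2 - deg b + (2 * int q - 2))"
      by (intro KC_sum wedge_KC t(1) h(1))
    from KC_carrier[OF this] KC_carrier[OF FK_coef[OF w(1), of b]]
    show ?thesis unfolding c_def wb_def by (simp add: koszul_carrier_iff)
  qed
  define g where "g a = (\<Sum>b\<in>bs. (\<lambda>S. E b * t a b S))" for a
  have zS: "z S = (\<Sum>b\<in>bs. E b * wb b S)" for S
  proof -
    have "z S = lift (d (w S))" by (simp add: w(2) lift_smul f0(2))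
    also have "w S = (\<Sum>b\<in>bs. smul (coef b (w S)) b)"
      by (rule FK_expansion[OF w(1) finbs]) (simp add: bs_def)
    finally show ?thesis by (simp add: d_sum d_smul lift_sum lift_smul E_def wb_def mult.commute)
  qed
  have "z - (\<Sum>a\<in>A. wedge (g a) (h a)) = (\<Sum>b\<in>bs. (\<lambda>S. E b * c b S))"
  proof (rule ext)
    fix S
    have "(\<Sum>a\<in>A. wedge (g a) (h a)) S = (\<Sum>a\<in>A. \<Sum>b\<in>bs. E b * wedge (t a b) (h a) S)"
      by (simp add: g_def wedge_sum_left wedge_mult_left sum_function_apply)
    also have "\<dots> = (\<Sum>b\<in>bs. \<Sum>a\<in>A. E b * wedge (t a b) (h a) S)" by (rule sum.swap)
    finally show "(z - (\<Sum>a\<in>A. wedge (g a) (h a))) S = (\<Sum>b\<in>bs. (\<lambda>S. E b * c b S)) S"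
      by (simp add: zS c_def sum_function_apply right_diff_distrib sum_subtractf sum_distrib_left)
  qed
  also have "\<dots> \<in> koszul_bd xs"
    by (intro koszul_bd_sum irrelevant_kills_homology E(2) cc dc)
  finally have bd: "z - (\<Sum>a\<in>A. wedge (g a) (h a)) \<in> koszul_bd xs" .
  have gKC: "g a \<in> KC 1 2" if "a \<in> A" for a
    unfolding g_def
  proof (rule KC_sum)
    fix b assume "b \<in> bs"
    from KC_mult[OF E(1)[OF this] t(1)[OF that, of b]] show "(\<lambda>S. E b * t a b S) \<in> KC 1 2" by simp
  qed
  have dg: "koszul_diff xs (g a) = 0" if "a \<in> A" for a
  proof (rule ext)
    fix S
    have "supp (d (u a)) \<subseteq> bs" using that by (auto simp: bs_def)
    then have "d (u a) = (\<Sum>b\<in>bs. smul (r a b) b)"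
      using coef_expansion[OF finbs] by (simp add: r_def)
    then have "lift (d (d (u a))) = (\<Sum>b\<in>bs. r a b * E b)"
      by (simp add: d_sum d_smul lift_sum lift_smul E_def)
    then have "(\<Sum>b\<in>bs. E b * r a b) = 0" by (simp add: d_square mult.commute)
    moreover have "koszul_diff xs (g a) S = (\<Sum>b\<in>bs. E b * scalar_form (r a b) S)"
      unfolding g_def koszul_diff_sum koszul_diff_mult t(2)[OF that] by (rule sum_function_apply)
    ultimately show "koszul_diff xs (g a) S = 0 S"
      by (cases "S = {}") (simp_all add: scalar_form_def)
  qed
  have "\<forall>a\<in>A. g a \<in> KC 1 2 \<and> koszul_diff xs (g a) = 0 \<and>
       h a \<in> KC (q - 1) (2 * int q - 2) \<and> koszul_diff xs (h a) = 0"
    using gKC dg h by blast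
  with finA Aj bd show ?thesis
    by (intro exI[of _ A] exI[of _ g] exI[of _ h] conjI)
qed

text \<open>
  In degree \<open>j > 2q\<close> the decomposition of a cycle has no terms. The case \<open>q = 0\<close> is separate, since
  there a coefficient of internal degree \<open>j > 0\<close> lies in \<open>R\<^sub>+ = \<partial>(K\<^sub>1)\<close> directly.
\<close>

lemma koszul_homology_vanishing:
  "q \<le> n \<Longrightarrow> j > 2 * int q \<Longrightarrow> z \<in> KC q j \<Longrightarrow> koszul_diff xs z = 0 \<Longrightarrow> z \<in> koszul_bd xs"
proof (induction q arbitrary: j z rule: less_induct)
  case (less q)
  show ?case
  proof (cases "q = 0")
    case True
    have z: "z = scalar_form (z {})"
    proof (rule ext)
      fix S
      have "S = {}" if "S \<subseteq> {..<length xs}" "card S = 0" using that finite_subset by fastforce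
      then show "z S = scalar_form (z {}) S"
        using forms_outside[OF less.prems(3), of S] True by (auto simp: scalar_form_def)
    qed
    have "z {} \<in> piece j" using forms_value[OF less.prems(3), of "{}"] True by simp
    then have "residue (z {}) = 0" using residue_piece less.prems(2) True by force
    from irrelevant_is_boundary[OF this] z show ?thesis unfolding koszul_bd_iff by metis
  next
    case False
    have v: "\<forall>q'<q. \<forall>e>2 * int q'. \<forall>z\<in>KC q' e. koszul_diff xs z = 0 \<longrightarrow> z \<in> koszul_bd xs"
    proof (intro allI impI ballI)
      fix q' e z' assume a: "q' < q" "e > 2 * int q'" "z' \<in> KC q' e" "koszul_diff xs z' = 0"
      then have "q' \<le> n" using less.prems(1) by simp
      from less.IH[OF a(1) this a(2,3,4)] show "z' \<in> koszul_bd xs" .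
    qed
    have "1 \<le> q" "j \<ge> 2 * int q" using False less.prems(2) by auto
    from cycle_decomposition[OF this(1) less.prems(1) this(2) v less.prems(3,4)]
    obtain A :: "'m set" and g h where "A \<noteq> {} \<longrightarrow> j = 2 * int q"
      "z - (\<Sum>a\<in>A. wedge (g a) (h a)) \<in> koszul_bd xs" by (elim exE conjE) (rule that, assumption+)
    then show ?thesis using less.prems(2) by auto
  qed
qed

end

section \<open>The homology algebra\<close>

lemma koszul_bd_plus: "koszul_bd xs + koszul_bd xs = koszul_bd xs"
proof (intro equalityI subsetI)
  fix f assume "f \<in> koszul_bd xs + koszul_bd xs"
  then show "f \<in> koszul_bd xs" by (auto elim!: set_plus_elim intro: koszul_bd_add)
next
  fix f assume "f \<in> koszul_bd xs"
  then have "0 + f \<in> koszul_bd xs + koszul_bd xs" by (intro set_plus_intro koszul_bd_zero)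
  then show "f \<in> koszul_bd xs + koszul_bd xs" by simp
qed

lemma coset_add: "(x +o koszul_bd xs) + (y +o koszul_bd xs) = (x + y) +o koszul_bd xs"
  by (simp add: set_plus_rearrange koszul_bd_plus)

lemma coset_zero: "0 +o koszul_bd xs = koszul_bd xs"
  by (simp add: elt_set_plus_def)

lemma coset_mono:
  assumes "x - y \<in> koszul_bd xs"
  shows "x +o koszul_bd xs \<subseteq> y +o koszul_bd xs"
proof
  fix f assume "f \<in> x +o koszul_bd xs"
  then obtain b where b: "f = x + b" "b \<in> koszul_bd xs" unfolding elt_set_plus_def by blast
  have "f = y + ((x - y) + b)" by (simp add: b)
  moreover have "(x - y) + b \<in> koszul_bd xs" by (rule koszul_bd_add[OF assms b(2)])
  ultimately show "f \<in> y +o koszul_bd xs" by (simp only: set_plus_intro2)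
qed

lemma coset_eqI:
  assumes "x - y \<in> koszul_bd xs"
  shows "x +o koszul_bd xs = y +o koszul_bd xs"
proof -
  have "y - x \<in> koszul_bd xs" using koszul_bd_uminus[OF assms] by simp
  then show ?thesis using coset_mono assms by blast
qed

lemma coset_bd: "x \<in> koszul_bd xs \<Longrightarrow> x +o koszul_bd xs = koszul_bd xs"
  using coset_eqI[of x 0 xs] by (simp add: coset_zero)

lemma coset_mem: "x \<in> x +o koszul_bd xs"
  using set_plus_intro2[OF koszul_bd_zero, of x] by simp

context graded_algebra_with_basis
begin

definition cycles :: "nat \<Rightarrow> int \<Rightarrow> (nat set \<Rightarrow> 'r) set" where
  "cycles q j = {z \<in> KC q j. koszul_diff xs z = 0}"

abbreviation class_of :: "(nat set \<Rightarrow> 'r) \<Rightarrow> (nat set \<Rightarrow> 'r) set" where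
  "class_of z \<equiv> z +o koszul_bd xs"

lemma koszul_homology_eq: "koszul_homology Rg xs i j = class_of ` cycles i (int j)"
  unfolding koszul_homology_def image_mod_def cycles_def koszul_component_eq by (rule refl)

lemma cycles_add: "x \<in> cycles q j \<Longrightarrow> y \<in> cycles q j \<Longrightarrow> x + y \<in> cycles q j"
  by (simp add: cycles_def KC_add koszul_diff_add)

lemma cycles_zero: "0 \<in> cycles q j"
  using KC_zero[of q j] by (simp only: cycles_def mem_Collect_eq koszul_diff_zero simp_thms)

lemma cycles_scale:
  assumes "x \<in> cycles q j"
  shows "(\<lambda>S. scale c (x S)) \<in> cycles q j"
proof -
  have "koszul_diff xs (\<lambda>S. scale c (x S)) = (\<lambda>S. scale c 1 * koszul_diff xs x S)"
    by (subst scale_eq_mult) (rule koszul_diff_mult)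
  then show ?thesis using assms KC_scale by (auto simp: cycles_def fun_eq_iff)
qed

lemma cycles_carrier: "x \<in> cycles q j \<Longrightarrow> x \<in> koszul_carrier xs"
  using KC_carrier[of x q j] by (simp add: cycles_def)

lemma cycles_wedge:
  assumes "x \<in> cycles p i" "y \<in> cycles q j"
  shows "wedge x y \<in> cycles (p + q) (i + j)"
  using assms leibniz[OF cycles_carrier[OF assms(1)] cycles_carrier[OF assms(2)]]
    wedge_KC[of x p i y q j] by (simp add: cycles_def)

lemma wedge_bd_right:
  assumes "x \<in> cycles q j" "b \<in> koszul_bd xs"
  shows "wedge x b \<in> koszul_bd xs"
proof -
  obtain k where k: "k \<in> koszul_carrier xs" "b = koszul_diff xs k"
    using assms(2) unfolding koszul_bd_iff by blast
  have x: "x \<in> KC q j" "koszul_diff xs x = 0" using assms(1) by (simp_all add: cycles_def)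
  have "(\<lambda>S. (- 1) ^ card S * x S) = (\<lambda>S. (- 1) ^ q * x S)"
    using forms_outside[OF x(1)] by (auto simp: fun_eq_iff) (metis mult_zero_right)
  then have "koszul_diff xs (wedge x k) = (\<lambda>S. (- 1) ^ q * wedge x b S)"
    using leibniz[OF KC_carrier[OF x(1)] k(1)] by (simp add: x(2) k(2) wedge_mult_left)
  then have "(\<lambda>S. (- 1) ^ q * wedge x b S) \<in> koszul_bd xs"
    unfolding koszul_bd_iff using koszul_carrier_wedge[OF KC_carrier[OF x(1)] k(1)] by metis
  from koszul_bd_mult[OF this, of "(- 1) ^ q"] show ?thesis
    by (simp add: unit_sign_square flip: mult.assoc)
qed

text \<open>
  The set-theoretic product of two classes is a single coset: changing either factor by a boundary,
  homogeneous or not, changes the product by a boundary.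
\<close>

lemma homology_mult_class:
  assumes "x \<in> cycles p i" "y \<in> cycles q j"
  shows "homology_mult xs (class_of x) (class_of y) = class_of (wedge x y)"
proof -
  have "class_of (wedge x' y') = class_of (wedge x y)" if rep: "x' \<in> class_of x" "y' \<in> class_of y" for x' y'
  proof -
    obtain b where b: "x' = x + b" "b \<in> koszul_bd xs"
      using rep(1) unfolding elt_set_plus_def by blast
    obtain b' where b': "y' = y + b'" "b' \<in> koszul_bd xs"
      using rep(2) unfolding elt_set_plus_def by blast
    have y': "y' \<in> koszul_carrier xs" "koszul_diff xs y' = 0"
      using assms(2) b'(2) cycles_carrier[OF assms(2)] koszul_bd_carrier koszul_bd_cycle
      by (auto simp: b'(1) cycles_def koszul_diff_add intro: koszul_carrier_add)
    have "wedge x' y' - wedge x y = wedge x b' + wedge b y'"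
      by (simp add: b(1) b'(1) wedge_add_left wedge_add_right)
    also have "\<dots> \<in> koszul_bd xs"
      by (intro koszul_bd_add wedge_bd_right[OF assms(1) b'(2)] wedge_bd_left[OF b(2) y'])
    finally show ?thesis by (rule coset_eqI)
  qed
  then have "homology_mult xs (class_of x) (class_of y)
      = (\<Union>x'\<in>class_of x. \<Union>y'\<in>class_of y. class_of (wedge x y))"
    unfolding homology_mult_def by (intro SUP_cong refl) blast
  then show ?thesis using coset_mem[of x xs] coset_mem[of y xs] by auto
qed

lemma homology_scale_class:
  "homology_scale scale xs c (class_of x) = class_of (\<lambda>S. scale c (x S))"
proof -
  have "class_of (\<lambda>S. scale c (x' S)) = class_of (\<lambda>S. scale c (x S))" if rep: "x' \<in> class_of x" for x'
  proof (rule coset_eqI)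
    obtain b where b: "x' = x + b" "b \<in> koszul_bd xs" using rep unfolding elt_set_plus_def by blast
    have "(\<lambda>S. scale c (x' S)) - (\<lambda>S. scale c (x S)) = (\<lambda>S. scale c 1 * b S)"
      by (simp add: b(1) fun_eq_iff scale_right_distrib flip: scale_eq_mult)
    then show "(\<lambda>S. scale c (x' S)) - (\<lambda>S. scale c (x S)) \<in> koszul_bd xs"
      using koszul_bd_mult[OF b(2)] by simp
  qed
  then have "homology_scale scale xs c (class_of x) = (\<Union>x'\<in>class_of x. class_of (\<lambda>S. scale c (x S)))"
    unfolding homology_scale_def by (intro SUP_cong refl) blast
  then show ?thesis using coset_mem[of x xs] by auto
qed

lemma wedge_one_cycle: "wedge_one \<in> cycles 0 0"
proof -
  have "wedge_one \<in> KC 0 0" using one_in_piece by (intro formsI) (auto simp: wedge_one_def)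
  then show ?thesis using koszul_diff_KC_0 by (simp add: cycles_def)
qed

abbreviation H12_power :: "nat \<Rightarrow> (nat set \<Rightarrow> 'r) set set" where
  "H12_power i \<equiv> homology_power scale xs (class_of ` cycles 1 2) i"

lemma products_are_classes:
  "X \<in> homology_products xs (class_of ` cycles 1 2) i \<Longrightarrow> X \<in> class_of ` cycles i (2 * int i)"
proof (induction i arbitrary: X)
  case 0
  then show ?case using wedge_one_cycle by (auto simp: homology_one_def)
next
  case (Suc i)
  then obtain x y where xy: "x \<in> cycles 1 2" "y \<in> cycles i (2 * int i)"
    "X = homology_mult xs (class_of x) (class_of y)" by auto blast
  then have "X = class_of (wedge x y)" using homology_mult_class by simp
  moreover have "wedge x y \<in> cycles (1 + i) (2 + 2 * int i)" by (rule cycles_wedge[OF xy(1,2)])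
  ultimately show ?case by (simp add: algebra_simps)
qed

lemma power_are_classes: "X \<in> H12_power i \<Longrightarrow> X \<in> class_of ` cycles i (2 * int i)"
  unfolding homology_power_def
proof (induction rule: homology_span.induct)
  case zero
  show ?case using cycles_zero coset_zero by (metis image_eqI)
next
  case (base X)
  then show ?case by (rule products_are_classes)
next
  case (add X Y)
  then obtain x y where "x \<in> cycles i (2 * int i)" "X = class_of x"
    "y \<in> cycles i (2 * int i)" "Y = class_of y" by blast
  then show ?case using cycles_add[of x i "2 * int i" y] by (simp only: coset_add image_eqI)
next
  case (scale X c)
  then show ?case using cycles_scale homology_scale_class by auto
qed

lemma power_mult:
  assumes x: "x \<in> cycles 1 2" and Y: "Y \<in> H12_power i"
  shows "homology_mult xs (class_of x) Y \<in> H12_power (Suc i)"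
  using Y unfolding homology_power_def
proof (induction rule: homology_span.induct)
  case zero
  have "homology_mult xs (class_of x) (class_of 0) = class_of (wedge x 0)"
    by (rule homology_mult_class[OF x cycles_zero])
  then show ?case by (simp add: coset_zero homology_span.zero)
next
  case (base Y)
  then show ?case using x by (intro homology_span.base) auto
next
  case (add X Y)
  obtain a b where ab: "a \<in> cycles i (2 * int i)" "X = class_of a" "b \<in> cycles i (2 * int i)" "Y = class_of b"
    using power_are_classes[of X i] power_are_classes[of Y i] add.hyps unfolding homology_power_def by blast
  have "homology_mult xs (class_of x) (X + Y)
      = homology_mult xs (class_of x) X + homology_mult xs (class_of x) Y"
    unfolding ab(2,4) coset_add
    by (simp add: homology_mult_class[OF x ab(1)] homology_mult_class[OF x ab(3)]
        homology_mult_class[OF x cycles_add[OF ab(1,3)]] wedge_add_right coset_add)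
  then show ?case using add.IH by (simp add: homology_span.add)
next
  case (scale X c)
  obtain a where a: "a \<in> cycles i (2 * int i)" "X = class_of a"
    using power_are_classes[of X i] scale.hyps unfolding homology_power_def by blast
  have "wedge x (\<lambda>S. scale c (a S)) = (\<lambda>S. scale c (wedge x a S))"
    by (subst (1 2) scale_eq_mult) (rule wedge_mult_right)
  then have "homology_mult xs (class_of x) (homology_scale scale xs c X)
      = homology_scale scale xs c (homology_mult xs (class_of x) X)"
    unfolding a(2) homology_scale_class homology_mult_class[OF x a(1)]
      homology_mult_class[OF x cycles_scale[OF a(1)]] by (rule arg_cong)
  then show ?case using scale.IH by (simp add: homology_span.scale)
qed

lemma power_sum:
  assumes "\<And>a. a \<in> A \<Longrightarrow> class_of (f a) \<in> H12_power i"
  shows "class_of (\<Sum>a\<in>A. f a) \<in> H12_power i"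
  using assms
proof (induction A rule: infinite_finite_induct)
  case (insert a A)
  have eq: "class_of (sum f (insert a A)) = class_of (f a) + class_of (sum f A)"
    unfolding coset_add using insert.hyps by (subst sum.insert) auto
  have "class_of (f a) \<in> H12_power i" "class_of (sum f A) \<in> H12_power i"
    using insert.prems insert.IH by blast+
  then show ?case unfolding eq homology_power_def by (rule homology_span.add)
next
  case empty
  show ?case unfolding sum.empty coset_zero homology_power_def by (rule homology_span.zero)
next
  case (infinite A)
  show ?case unfolding sum.infinite[OF infinite(1)] coset_zero homology_power_def by (rule homology_span.zero)
qed

lemma power_0:
  assumes "z \<in> cycles 0 0"
  shows "class_of z \<in> H12_power 0"
proof -
  have z: "z \<in> KC 0 0" using assms by (simp add: cycles_def)
  have "z {} \<in> piece 0" using forms_value[OF z, of "{}"] by simp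
  then have z0: "z {} = scale (residue (z {})) 1" by (rule piece_0_eq)
  have "z = (\<lambda>S. scale (residue (z {})) (wedge_one S))"
  proof (rule ext)
    fix S
    have "S = {}" if "S \<subseteq> {..<length xs}" "card S = 0" using that finite_subset by fastforce
    then show "z S = scale (residue (z {})) (wedge_one S)"
      using forms_outside[OF z, of S] z0 by (auto simp: wedge_one_def)
  qed
  then have "class_of z = homology_scale scale xs (residue (z {})) (homology_one xs)"
    unfolding homology_one_def homology_scale_class by simp
  then show ?thesis
    unfolding homology_power_def by (simp add: homology_span.scale homology_span.base)
qed

end

context linear_koszul_resolution
begin

text \<open>
  Induction on \<open>i\<close>: a cycle of bidegree \<open>(i+1, 2i+2)\<close> is, up to a boundary, a sum of products of
  cycles of bidegree \<open>(1, 2)\<close> with cycles of bidegree \<open>(i, 2i)\<close>.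
\<close>

lemma diagonal_classes_in_power:
  "i \<le> n \<Longrightarrow> z \<in> cycles i (2 * int i) \<Longrightarrow> class_of z \<in> H12_power i"
proof (induction i arbitrary: z)
  case 0
  then show ?case using power_0 by simp
next
  case (Suc i)
  have z: "z \<in> KC (Suc i) (2 * int (Suc i))" "koszul_diff xs z = 0"
    using Suc.prems(2) unfolding cycles_def by blast+
  have v: "\<forall>q'<Suc i. \<forall>e>2 * int q'. \<forall>z\<in>KC q' e. koszul_diff xs z = 0 \<longrightarrow> z \<in> koszul_bd xs"
    using koszul_homology_vanishing Suc.prems(1) by (metis le_trans less_or_eq_imp_le)
  have one: "1 \<le> Suc i" by simp
  obtain A :: "'m set" and g h where
    gh: "\<forall>a\<in>A. g a \<in> KC 1 2 \<and> koszul_diff xs (g a) = 0 \<and>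
       h a \<in> KC (Suc i - 1) (2 * int (Suc i) - 2) \<and> koszul_diff xs (h a) = 0"
    and bd: "z - (\<Sum>a\<in>A. wedge (g a) (h a)) \<in> koszul_bd xs"
    using cycle_decomposition[OF one Suc.prems(1) order_refl v z]
    by (elim exE conjE) (rule that, assumption+)
  have "class_of (wedge (g a) (h a)) \<in> H12_power (Suc i)" if "a \<in> A" for a
  proof -
    have g: "g a \<in> cycles 1 2" and h: "h a \<in> cycles i (2 * int i)"
      using gh that by (auto simp: cycles_def)
    have "class_of (h a) \<in> H12_power i" using Suc.IH[OF _ h] Suc.prems(1) by simp
    from power_mult[OF g this] show ?thesis by (simp add: homology_mult_class[OF g h])
  qed
  then have "class_of (\<Sum>a\<in>A. wedge (g a) (h a)) \<in> H12_power (Suc i)" by (rule power_sum)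
  then show ?case using coset_eqI[OF bd] by simp
qed

end

text \<open>
  The maximum bounds every \<open>t\<^sub>p - p\<close>, hence \<open>t\<^sub>p \<le> p\<close>.
\<close>

lemma tor_vanishing_of_regularity:
  assumes reg: "tor_reg scale Rg smul B deg d m = 0" and p: "p \<le> m" "j > int p"
  shows "tor scale Rg smul B deg d p j = {tor_bd scale Rg smul d}"
proof (rule ccontr)
  assume "\<not> ?thesis"
  then have "ereal (of_int j) \<le> tor_top scale Rg smul B deg d p"
    unfolding tor_top_def by (intro SUP_upper) simp
  moreover have "tor_top scale Rg smul B deg d p - ereal (real p) \<le> tor_reg scale Rg smul B deg d m"
    unfolding tor_reg_def using p(1) by (intro Max_ge) auto
  then have "tor_top scale Rg smul B deg d p \<le> ereal (real p)"
    unfolding reg by (cases "tor_top scale Rg smul B deg d p") auto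
  ultimately have "ereal (of_int j) \<le> ereal (real p)" by (rule order_trans)
  then show False using p(2) by simp
qed

theorem theorem4p1:
  fixes scale :: "'k::field \<Rightarrow> 'r::comm_ring_1 \<Rightarrow> 'r"
    and Rg :: "nat \<Rightarrow> 'r set"
    and smul :: "'r \<Rightarrow> 'm::ab_group_add \<Rightarrow> 'm"
    and B :: "nat \<Rightarrow> 'm set" and deg :: "'m \<Rightarrow> int" and d :: "'m \<Rightarrow> 'm" and eps :: "'m \<Rightarrow> 'k"
    and xs :: "'r list" and n :: nat
  assumes "standard_graded_algebra scale Rg"
    and "graded_free_resolution scale Rg smul B deg d eps"
    and "ordered_basis scale (Rg 1) xs"
    and "tor_reg scale Rg smul B deg d (n + 1) = 0"
  shows "\<forall>i\<le>n. (\<forall>j>2 * i. koszul_homology Rg xs i j = {koszul_bd xs})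
           \<and> koszul_homology Rg xs i (2 * i)
               = homology_power scale xs (koszul_homology Rg xs 1 2) i"
proof -
  interpret linear_koszul_resolution scale Rg smul B deg d eps xs n
  proof (intro linear_koszul_resolution.intro koszul_resolution.intro graded_algebra_with_basis.intro
      graded_algebra_with_basis_axioms.intro linear_koszul_resolution_axioms.intro assms(1-3))
    fix p j assume "p \<le> Suc n" "j > int p"
    then show "tor scale Rg smul B deg d p j = {tor_bd scale Rg smul d}"
      using tor_vanishing_of_regularity[OF assms(4)] by simp
  qed
  have H: "koszul_homology Rg xs 1 2 = class_of ` cycles 1 2"
    using koszul_homology_eq[of 1 2] by simp
  show ?thesis
  proof (intro allI impI conjI)
    fix i j assume i: "i \<le> n" and j: "2 * i < j"
    have "class_of z = koszul_bd xs" if "z \<in> cycles i (int j)" for z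
    proof (rule coset_bd, rule koszul_homology_vanishing[OF i])
      show "int j > 2 * int i" using j by linarith
      show "z \<in> KC i (int j)" "koszul_diff xs z = 0" using that unfolding cycles_def by blast+
    qed
    then show "koszul_homology Rg xs i j = {koszul_bd xs}"
      unfolding koszul_homology_eq using cycles_zero[of i "int j"] by blast
  next
    fix i assume i: "i \<le> n"
    have "koszul_homology Rg xs i (2 * i) = class_of ` cycles i (2 * int i)"
      by (simp add: koszul_homology_eq)
    also have "\<dots> = H12_power i"
      using diagonal_classes_in_power[OF i] power_are_classes by blast
    finally show "koszul_homology Rg xs i (2 * i) = homology_power scale xs (koszul_homology Rg xs 1 2) i"
      unfolding H .
  qed
qed

end
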